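(* Let $0<\alpha<1$, $T>0$, $\lambda\in\mathbb R$, let $f$ be a bounded function on $[0,T]$, let $n\ge 1$ be an integer, and let $v$ be the solution of $$\partial_t^\alpha v(t)+\lambda v(t)=\big((-\lambda I_t^\alpha)^n f\big)(t),\quad t\in(0,T];\qquad v(0)=0.$$ Equivalently, $v=u-I_t^\alpha\sum_{i=0}^{n-1}(-\lambda I_t^\alpha)^i f$, where $u$ is the solution of $\partial_t^\alpha u+\lambda u=f$ on $(0,T]$, $u(0)=0$. Then the following statements hold. (i) If $f(0)$ exists and $|f'(t)|\le Qt^{-\sigma}$ on $(0,T]$ for some $\sigma<1$, then $|v'(t)|\le Q\,t^{(n+1)\alpha-1}$ for $t\in(0,T]$. (ii) If $f'(0)$ exists and $|f''(t)|\le Qt^{-\tilde\sigma}$ on $(0,T]$ for some $\tilde\sigma<1$, then $|v''(t)|\le Q\,t^{(n+1)\alpha-2}$ for $t\in(0,T]$.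
   Context: For $\nu>0$ set $\beta_\nu(t):=t^{\nu-1}/\Gamma(\nu)$, and define the fractional integral $I_t^\nu g(t):=(\beta_\nu*g)(t)=\frac1{\Gamma(\nu)}\int_0^t\frac{g(s)\,ds}{(t-s)^{1-\nu}}$, where $(g*h)(t)=\int_0^t g(t-s)h(s)\,ds$. For $0<\alpha<1$ the fractional derivative is $\partial_t^\alpha g:=I_t^{1-\alpha}g'$. Powers such as $(-\lambda I_t^\alpha)^i$ denote iterated application of the operator, with $(-\lambda I_t^\alpha)^0$ the identity. Here $f(0)$ and $f'(0)$ denote the (finite) values at $t=0$, taken as one-sided limits as $t\to0^+$. $Q$ denotes a generic positive constant, independent of $t$, that may take different values at different occurrences (it may depend on $\alpha,\lambda,n,T$ and $f$). *)

theory Defs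
  imports "HOL-Analysis.Analysis"
begin

definition frac_kernel :: "real \<Rightarrow> real \<Rightarrow> real" where
  "frac_kernel \<nu> t = t powr (\<nu> - 1) / Gamma \<nu>"

text \<open>At \<open>s = t\<close> the kernel of order below 1 takes the conventional value
  \<open>0 powr a = 0\<close>, on a null set.\<close>

definition conv :: "(real \<Rightarrow> real) \<Rightarrow> (real \<Rightarrow> real) \<Rightarrow> real \<Rightarrow> real" where
  "conv g h t = integral {0..t} (\<lambda>s. g (t - s) * h s)"

definition frac_integral :: "real \<Rightarrow> (real \<Rightarrow> real) \<Rightarrow> real \<Rightarrow> real" where
  "frac_integral \<nu> g = conv (frac_kernel \<nu>) g"

text \<open>Functions are only considered on \<open>[0,T]\<close>, so the derivative at the right endpoint
  \<open>T\<close> is one-sided; at interior points it is the usual derivative.\<close>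

definition deriv_upto :: "real \<Rightarrow> (real \<Rightarrow> real) \<Rightarrow> real \<Rightarrow> real" where
  "deriv_upto T g t = vector_derivative g (at t within {0<..T})"

definition frac_deriv :: "real \<Rightarrow> real \<Rightarrow> (real \<Rightarrow> real) \<Rightarrow> real \<Rightarrow> real" where
  "frac_deriv T \<alpha> g = frac_integral (1 - \<alpha>) (deriv_upto T g)"

definition neg_frac_op :: "real \<Rightarrow> real \<Rightarrow> (real \<Rightarrow> real) \<Rightarrow> real \<Rightarrow> real" where
  "neg_frac_op \<alpha> lam g = (\<lambda>t. - lam * frac_integral \<alpha> g t)"

text \<open>Classical solutions of \<open>\<partial>\<^sub>t\<^sup>\<alpha> w + lam w = g\<close> on \<open>(0,T]\<close>, \<open>w(0) = 0\<close>: the function is in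
  \<open>C[0,T] \<inter> C\<^sup>1(0,T]\<close> and its derivative, which may be singular at 0, is in \<open>L\<^sup>1(0,T)\<close>.
  Integrability excludes the junk value of the integral in the fractional derivative.\<close>

definition frac_solution ::
  "real \<Rightarrow> real \<Rightarrow> real \<Rightarrow> (real \<Rightarrow> real) \<Rightarrow> (real \<Rightarrow> real) \<Rightarrow> bool" where
  "frac_solution T \<alpha> lam g w \<longleftrightarrow>
     continuous_on {0..T} w \<and>
     w differentiable_on {0<..T} \<and>
     continuous_on {0<..T} (deriv_upto T w) \<and>
     deriv_upto T w absolutely_integrable_on {0<..T} \<and>
     (\<forall>t\<in>{0<..T}. frac_deriv T \<alpha> w t + lam * w t = g t) \<and>
     w 0 = 0"

end

theory Submission
  imports Defs
begin

text \<open>Write \<open>I\<^sup>\<nu>\<close> for the fractional integral of order \<open>\<nu>\<close> and \<open>A = -lam I\<^sup>\<alpha>\<close>. Everything rests on the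
semigroup law \<open>I\<^sup>\<mu> I\<^sup>\<nu> = I\<^sup>\<mu>\<^sup>+\<^sup>\<nu>\<close> (\<open>frac_integral_semigroup\<close>), which is Fubini's theorem together with the
Beta integral. It is applied to functions that are integrable on \<open>(0,T]\<close> and bounded on
each \<open>[a,T]\<close> with \<open>a > 0\<close> (\<open>admissible\<close>): this class allows an integrable singularity at the origin, it is closed under all
the operators, and \<open>I\<^sup>\<nu>\<close> maps it to functions that are continuous on \<open>(0,T]\<close>, so that identities hold
at every point and not just almost everywhere.

A solution \<open>w\<close> with datum \<open>g\<close> is \<open>I\<^sup>1 p\<close> with \<open>p = w'\<close> and \<open>I\<^sup>1\<^sup>-\<^sup>\<alpha> p + lam I\<^sup>1 p = g\<close>. Applying
\<open>I\<^sup>\<alpha>\<close> turns the equation into \<open>I\<^sup>1 (p - A p) = I\<^sup>\<alpha> g\<close> (\<open>volterra_equation\<close>). Since \<open>I\<^sup>1\<close> is injective,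
two solutions differ by a \<open>d\<close> with \<open>d = A d\<close>, and iterating this identity forces \<open>d = 0\<close>
(\<open>volterra_homogeneous_zero\<close>).

For the equivalence, \<open>A\<close> commutes with every \<open>I\<^sup>\<nu>\<close>, so if \<open>u = I\<^sup>1 p\<close> solves the equation for \<open>f\<close>, then
\<open>A\<^sup>n u\<close> solves it for \<open>A\<^sup>n f\<close>. Moreover \<open>I\<^sup>\<alpha> A\<^sup>i f = A\<^sup>i I\<^sup>1 (p - A p) = A\<^sup>i u - A\<^sup>i\<^sup>+\<^sup>1 u\<close>, so the sum in the
statement telescopes to \<open>u - A\<^sup>n u\<close>, and uniqueness does the rest.

For the bounds, integrate \<open>f'\<close> to write \<open>f = c + I\<^sup>1 f'\<close>. The Volterra equation then becomes
\<open>q = h + A q\<close> for \<open>q = v'\<close>, where \<open>h\<close> is \<open>(-lam)\<^sup>n\<close> times \<open>c \<beta>\<^bsub>(n+1)\<alpha>\<^esub> + I\<^bsup>(n+1)\<alpha>\<^esup> f'\<close>, and \<open>m\<close>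
substitutions of this equation into itself give a finite expansion of \<open>q\<close> (\<open>density_expansion\<close>) whose
terms are power kernels and integrals \<open>I\<^sup>\<nu> f'\<close> of order at least \<open>(n+1)\<alpha>\<close>, plus a remainder
\<open>I\<^sup>\<mu> q\<close> of order \<open>\<mu>\<close> as large as desired. The leading term is a multiple of \<open>t\<^bsup>(n+1)\<alpha>-1\<^esup>\<close>; since
\<open>f'\<close> is bounded by a multiple of \<open>t\<^bsup>-\<sigma>\<^esup>\<close> with \<open>\<sigma> < 1\<close>, the other terms are of no larger order, and
the remainder is at most a multiple of \<open>t\<^bsup>\<mu>-1\<^esup>\<close> because \<open>q\<close> is integrable. For the second derivative the same expansion is differentiated term by
term, using \<open>f' = d + I\<^sup>1 f''\<close>.\<close>

section \<open>The power kernel and admissible functions\<close>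

text \<open>Cutting the kernel off at the origin replaces the integral over \<open>[0,t]\<close> by one over the whole line,
with no \<open>t\<close>-dependent domain, which is the form in which Fubini's theorem applies.\<close>

definition causal_kernel :: "real \<Rightarrow> real \<Rightarrow> real" where
  "causal_kernel \<nu> x = (if 0 < x then frac_kernel \<nu> x else 0)"

definition zero_ext :: "real \<Rightarrow> (real \<Rightarrow> real) \<Rightarrow> real \<Rightarrow> real" where
  "zero_ext T g s = (if s \<in> {0<..T} then g s else 0)"

text \<open>The second condition is what makes \<open>I\<^sup>\<nu> g (t)\<close> converge at every \<open>t\<close> when \<open>\<nu> < 1\<close>: the kernel
is singular at \<open>s = t\<close>, where \<open>g\<close> is bounded, while \<open>g\<close> may be singular at \<open>s = 0\<close>, where the kernel
is bounded.\<close>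

definition admissible :: "real \<Rightarrow> (real \<Rightarrow> real) \<Rightarrow> bool" where
  "admissible T g \<longleftrightarrow> integrable lborel (zero_ext T g) \<and> (\<forall>a>0. \<exists>M. \<forall>t\<in>{a..T}. \<bar>g t\<bar> \<le> M)"

lemma causal_kernel_measurable [measurable]: "causal_kernel \<nu> \<in> borel_measurable borel"
  unfolding causal_kernel_def[abs_def] frac_kernel_def by measurable

lemma causal_kernel_nonneg: "0 < \<nu> \<Longrightarrow> 0 \<le> causal_kernel \<nu> x"
  by (simp add: causal_kernel_def frac_kernel_def)

lemma causal_kernel_continuous_at: "x \<noteq> 0 \<Longrightarrow> isCont (causal_kernel \<nu>) x"
proof (cases "x > 0")
  case True
  have "isCont (frac_kernel \<nu>) x"
    unfolding frac_kernel_def[abs_def] divide_inverse using True by (intro continuous_intros) auto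
  moreover have "\<forall>\<^sub>F y in nhds x. causal_kernel \<nu> y = frac_kernel \<nu> y"
    using eventually_nhds_in_open[of "{0<..}" x] True
    by (auto simp: causal_kernel_def elim!: eventually_mono)
  ultimately show ?thesis by (simp add: isCont_cong)
next
  case False
  assume "x \<noteq> 0"
  then have "\<forall>\<^sub>F y in nhds x. causal_kernel \<nu> y = 0"
    using eventually_nhds_in_open[of "{..<0}" x] False
    by (auto simp: causal_kernel_def elim!: eventually_mono)
  then show ?thesis by (simp add: isCont_cong)
qed

lemma causal_kernel_bounded:
  assumes "0 < \<nu>" "0 < a"
  obtains C where "0 \<le> C" "\<And>x. a \<le> x \<or> x \<le> 0 \<Longrightarrow> x \<le> b \<Longrightarrow> causal_kernel \<nu> x \<le> C"
proof -
  have "continuous_on {a..b} (causal_kernel \<nu>)"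
    using assms(2) by (intro continuous_at_imp_continuous_on ballI causal_kernel_continuous_at) auto
  then have "bounded (causal_kernel \<nu> ` {a..b})"
    by (intro compact_imp_bounded compact_continuous_image) auto
  then obtain C where C: "\<forall>x\<in>{a..b}. \<bar>causal_kernel \<nu> x\<bar> \<le> C"
    unfolding bounded_iff by auto
  show ?thesis
  proof (rule that[of "max C 0"])
    fix x assume "a \<le> x \<or> x \<le> 0" "x \<le> b"
    then show "causal_kernel \<nu> x \<le> max C 0"
      using bspec[OF C, of x] by (auto simp: causal_kernel_def)
  qed auto
qed

section \<open>Convolution of power kernels\<close>

text \<open>The affine substitution \<open>s = r + (t - r) x\<close> reduces this to the Beta integral, and
\<open>B(\<nu>,\<mu>) = \<Gamma>(\<nu>) \<Gamma>(\<mu>) / \<Gamma>(\<mu> + \<nu>)\<close> cancels the normalising factors. The integral is taken in the extended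
nonnegative sense so that Tonelli's theorem can use it to establish integrability in the plane.\<close>

lemma nn_integral_causal_kernel_conv:
  assumes "0 < \<mu>" "0 < \<nu>"
  shows "(\<integral>\<^sup>+ s. ennreal (causal_kernel \<mu> (t - s) * causal_kernel \<nu> (s - r)) \<partial>lborel)
       = ennreal (causal_kernel (\<mu> + \<nu>) (t - r))"
proof (cases "r < t")
  case False
  then have *: "causal_kernel \<mu> (t - s) * causal_kernel \<nu> (s - r) = 0" for s
    by (auto simp: causal_kernel_def)
  show ?thesis using False by (simp add: * ) (simp add: causal_kernel_def)
next
  case True
  define d where "d = t - r"
  have d: "0 < d" using True by (simp add: d_def)
  (* the factor left over from rescaling both kernels to the unit interval *)
  define c where "c = d powr (\<mu> + \<nu> - 2) / (Gamma \<mu> * Gamma \<nu>)"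
  have c: "0 \<le> c" using assms by (simp add: c_def)
  define b where "b = (\<lambda>x::real. if x \<in> {0..1} then x powr (\<nu> - 1) * (1 - x) powr (\<mu> - 1) else 0)"
  have bm [measurable]: "b \<in> borel_measurable borel" unfolding b_def by measurable
  have "(b has_integral Beta \<nu> \<mu>) UNIV"
    unfolding b_def has_integral_restrict_UNIV by (rule has_integral_Beta_real) (use assms in auto)
  then have bI: "(\<integral>\<^sup>+ x. ennreal (b x) \<partial>lborel) = Beta \<nu> \<mu>"
    by (intro nn_integral_has_integral_lborel) (auto simp: b_def)
  have eq: "causal_kernel \<mu> (t - (r + d * x)) * causal_kernel \<nu> (r + d * x - r) = c * b x" for x
  proof (cases "x \<in> {0<..<1}")
    case True
    have "t - (r + d * x) = d * (1 - x)" by (simp add: d_def algebra_simps)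
    then show ?thesis using True d
      by (simp add: causal_kernel_def frac_kernel_def b_def c_def powr_mult flip: powr_add)
  next
    case False
    then have "x \<le> 0 \<or> 1 \<le> x" by auto
    moreover have "t - (r + d * x) = d * (1 - x)" by (simp add: d_def algebra_simps)
    ultimately show ?thesis using d
      by (auto simp: causal_kernel_def b_def zero_less_mult_iff)
  qed
  have "(\<integral>\<^sup>+ s. ennreal (causal_kernel \<mu> (t - s) * causal_kernel \<nu> (s - r)) \<partial>lborel)
      = ennreal d * (\<integral>\<^sup>+ x. ennreal (c * b x) \<partial>lborel)"
    using d by (subst nn_integral_real_affine[where c = d and t = r]) (auto simp: eq[simplified])
  also have "\<dots> = ennreal (d * c * Beta \<nu> \<mu>)"
    using c d bI by (simp add: ennreal_mult' nn_integral_cmult mult.assoc)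
  also have "d * c * Beta \<nu> \<mu> = causal_kernel (\<mu> + \<nu>) (t - r)"
  proof -
    have "d * d powr (\<mu> + \<nu> - 2) = d powr (\<mu> + \<nu> - 1)"
      using d powr_add[of d 1 "\<mu> + \<nu> - 2"] by simp
    moreover have "Gamma \<mu> > 0" "Gamma \<nu> > 0" using assms by auto
    ultimately show ?thesis using d
      by (simp add: causal_kernel_def frac_kernel_def c_def Beta_def d_def[symmetric] add.commute
                    less_imp_neq[symmetric] field_simps)
  qed
  finally show ?thesis .
qed

lemma causal_kernel_conv_integrable:
  assumes "0 < \<mu>" "0 < \<nu>"
  shows "integrable lborel (\<lambda>s. causal_kernel \<mu> (t - s) * causal_kernel \<nu> (s - r))"
    and "(LINT s|lborel. causal_kernel \<mu> (t - s) * causal_kernel \<nu> (s - r)) = causal_kernel (\<mu> + \<nu>) (t - r)"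
proof -
  have "has_bochner_integral lborel (\<lambda>s. causal_kernel \<mu> (t - s) * causal_kernel \<nu> (s - r))
          (causal_kernel (\<mu> + \<nu>) (t - r))"
    using assms
    by (intro has_bochner_integral_nn_integral nn_integral_causal_kernel_conv)
       (auto intro!: causal_kernel_nonneg mult_nonneg_nonneg)
  then show "integrable lborel (\<lambda>s. causal_kernel \<mu> (t - s) * causal_kernel \<nu> (s - r))"
    and "(LINT s|lborel. causal_kernel \<mu> (t - s) * causal_kernel \<nu> (s - r)) = causal_kernel (\<mu> + \<nu>) (t - r)"
    by (auto simp: has_bochner_integral_iff)
qed

lemma causal_kernel_1: "causal_kernel 1 x = (if 0 < x then 1 else 0)"
  by (simp add: causal_kernel_def frac_kernel_def)

section \<open>Fractional integrals of admissible functions\<close>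

lemma admissible_integrable: "admissible T g \<Longrightarrow> integrable lborel (zero_ext T g)"
  by (simp add: admissible_def)

lemma admissible_bounded:
  assumes "admissible T g" "0 < a"
  obtains M where "0 \<le> M" "\<And>s. a \<le> s \<Longrightarrow> \<bar>zero_ext T g s\<bar> \<le> M"
proof -
  obtain M where "\<forall>t\<in>{a..T}. \<bar>g t\<bar> \<le> M"
    using assms unfolding admissible_def by blast
  then show ?thesis by (intro that[of "max M 0"]) (force simp: zero_ext_def le_max_iff_disj)+
qed

text \<open>Split at \<open>s = t/2\<close>: to the left the kernel is bounded and \<open>g\<close> integrable, to the right \<open>g\<close> is
bounded and the kernel integrable.\<close>

lemma integrable_kernel_times:
  assumes g: "admissible T g" and "0 < \<nu>" and "t \<le> T"
  shows "integrable lborel (\<lambda>s. causal_kernel \<nu> (t - s) * zero_ext T g s)"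
proof (cases "0 < t")
  case False
  then have "(\<lambda>s. causal_kernel \<nu> (t - s) * zero_ext T g s) = (\<lambda>s. 0)"
    by (auto simp: causal_kernel_def zero_ext_def)
  then show ?thesis by simp
next
  case True
  note [measurable] = borel_measurable_integrable[OF admissible_integrable[OF g]]
  obtain C where C: "0 \<le> C" "\<And>x. t / 2 \<le> x \<or> x \<le> 0 \<Longrightarrow> x \<le> T \<Longrightarrow> causal_kernel \<nu> x \<le> C"
    using causal_kernel_bounded[of \<nu> "t / 2" T] assms True by auto
  obtain M where M: "0 \<le> M" "\<And>s. t / 2 \<le> s \<Longrightarrow> \<bar>zero_ext T g s\<bar> \<le> M"
    using admissible_bounded[OF g, of "t / 2"] True by auto
  have "integrable lborel (\<lambda>s. C * \<bar>zero_ext T g s\<bar> + M * (causal_kernel \<nu> (t - s) * causal_kernel 1 (s - 0)))"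
    using causal_kernel_conv_integrable(1)[of \<nu> 1 t 0] admissible_integrable[OF g] \<open>0 < \<nu>\<close> by auto
  then show ?thesis
  proof (rule Bochner_Integration.integrable_bound)
    show "AE s in lborel. norm (causal_kernel \<nu> (t - s) * zero_ext T g s)
        \<le> norm (C * \<bar>zero_ext T g s\<bar> + M * (causal_kernel \<nu> (t - s) * causal_kernel 1 (s - 0)))"
    proof (rule AE_I2)
      fix s
      have nn: "0 \<le> causal_kernel \<nu> (t - s)" using \<open>0 < \<nu>\<close> by (rule causal_kernel_nonneg)
      consider "s \<le> 0" | "0 < s" "s \<le> t / 2" | "t / 2 < s" by linarith
      then have "causal_kernel \<nu> (t - s) * \<bar>zero_ext T g s\<bar>
            \<le> C * \<bar>zero_ext T g s\<bar> + M * (causal_kernel \<nu> (t - s) * causal_kernel 1 (s - 0))"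
      proof cases
        case 1 then show ?thesis by (simp add: zero_ext_def causal_kernel_1)
      next
        case 2
        then have "causal_kernel \<nu> (t - s) \<le> C" using \<open>t \<le> T\<close> by (intro C(2)) auto
        then show ?thesis using nn M(1) by (intro add_increasing2 mult_right_mono) (auto simp: causal_kernel_1)
      next
        case 3
        then have "\<bar>zero_ext T g s\<bar> * causal_kernel \<nu> (t - s) \<le> M * causal_kernel \<nu> (t - s)"
          using nn by (intro mult_right_mono M(2)) auto
        moreover have "causal_kernel 1 (s - 0) = 1" using 3 True by (simp add: causal_kernel_1)
        ultimately show ?thesis using C(1) by (simp add: mult.commute add_increasing)
      qed
      then show "norm (causal_kernel \<nu> (t - s) * zero_ext T g s)
        \<le> norm (C * \<bar>zero_ext T g s\<bar> + M * (causal_kernel \<nu> (t - s) * causal_kernel 1 (s - 0)))"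
        using nn by (simp add: abs_mult)
    qed
  qed simp
qed

text \<open>The two integrands agree on \<open>(0,t)\<close> and vanish outside \<open>[0,t]\<close>; the endpoints form a null set.\<close>

lemma frac_integral_eq_lborel:
  assumes g: "admissible T g" and "0 < \<nu>" and t: "0 \<le> t" "t \<le> T"
  shows "frac_integral \<nu> g t = (LINT s|lborel. causal_kernel \<nu> (t - s) * zero_ext T g s)"
proof -
  have "frac_integral \<nu> g t = integral UNIV (\<lambda>s. if s \<in> {0..t} then frac_kernel \<nu> (t - s) * g s else 0)"
    unfolding frac_integral_def conv_def integral_restrict_UNIV ..
  also have "\<dots> = integral UNIV (\<lambda>s. causal_kernel \<nu> (t - s) * zero_ext T g s)"
    by (rule integral_spike[of "{0, t}"]) (use t in \<open>auto simp: causal_kernel_def zero_ext_def\<close>)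
  also have "\<dots> = (LINT s|lborel. causal_kernel \<nu> (t - s) * zero_ext T g s)"
    by (rule integral_lborel[OF integrable_kernel_times[OF g]]) (use assms in auto)
  finally show ?thesis .
qed

lemma integrable_kernel_plane:
  assumes g: "admissible T g" and \<mu>: "0 < \<mu>" and \<nu>: "0 < \<nu>" and t: "t \<le> T"
  shows "integrable (lborel \<Otimes>\<^sub>M lborel)
           (\<lambda>(s, r). causal_kernel \<mu> (t - s) * (causal_kernel \<nu> (s - r) * zero_ext T g r))"
proof (rule integrableI_bounded)
  note [measurable] = borel_measurable_integrable[OF admissible_integrable[OF g]]
  let ?F = "\<lambda>(s, r). causal_kernel \<mu> (t - s) * (causal_kernel \<nu> (s - r) * zero_ext T g r)"
  show "?F \<in> borel_measurable (lborel \<Otimes>\<^sub>M lborel)" by measurable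
  have "(\<integral>\<^sup>+ z. ennreal (norm (?F z)) \<partial>(lborel \<Otimes>\<^sub>M lborel))
      = (\<integral>\<^sup>+ r. (\<integral>\<^sup>+ s. ennreal (norm (?F (s, r))) \<partial>lborel) \<partial>lborel)"
    by (rule lborel_pair.nn_integral_snd[symmetric]) measurable
  also have "\<dots> = (\<integral>\<^sup>+ r. (\<integral>\<^sup>+ s. ennreal (causal_kernel \<mu> (t - s) * causal_kernel \<nu> (s - r))
                       * ennreal \<bar>zero_ext T g r\<bar> \<partial>lborel) \<partial>lborel)"
    using causal_kernel_nonneg[OF \<mu>] causal_kernel_nonneg[OF \<nu>]
    by (intro nn_integral_cong) (simp add: abs_mult flip: ennreal_mult' mult.assoc)
  also have "\<dots> = (\<integral>\<^sup>+ r. ennreal (norm (causal_kernel (\<mu> + \<nu>) (t - r) * zero_ext T g r)) \<partial>lborel)"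
    using causal_kernel_nonneg[of "\<mu> + \<nu>"] \<mu> \<nu>
    by (intro nn_integral_cong)
       (simp add: nn_integral_multc nn_integral_causal_kernel_conv abs_mult flip: ennreal_mult')
  also have "\<dots> < \<infinity>"
    using integrable_kernel_times[OF g, of "\<mu> + \<nu>" t] \<mu> \<nu> t unfolding integrable_iff_bounded by simp
  finally show "(\<integral>\<^sup>+ z. ennreal (norm (?F z)) \<partial>(lborel \<Otimes>\<^sub>M lborel)) < \<infinity>" .
qed

text \<open>Dominated convergence: for fixed \<open>s \<noteq> t - d\<close> the integrand is continuous at \<open>t\<close>, so a single
discontinuity of the kernel does no harm. Serves for kernels truncated near 0 and for the jump of the
kernel of order 1.\<close>

lemma continuous_on_truncated_conv:
  fixes k E :: "real \<Rightarrow> real"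
  assumes [measurable]: "k \<in> borel_measurable borel" and E: "integrable lborel E"
    and k: "\<And>x. x \<le> T \<Longrightarrow> \<bar>k x\<bar> \<le> C" and cont: "\<And>x. x \<noteq> d \<Longrightarrow> isCont k x"
    and E0: "\<And>s. s \<le> 0 \<Longrightarrow> E s = 0"
  shows "continuous_on {..T} (\<lambda>t. LINT s|lborel. k (t - s) * E s)"
proof (rule continuous_on_sequentiallyI)
  note [measurable] = borel_measurable_integrable[OF E]
  fix u :: "nat \<Rightarrow> real" and t assume u: "\<forall>n. u n \<in> {..T}" "t \<in> {..T}" "u \<longlonglongrightarrow> t"
  show "(\<lambda>n. LINT s|lborel. k (u n - s) * E s) \<longlonglongrightarrow> (LINT s|lborel. k (t - s) * E s)"
  proof (rule integral_dominated_convergence)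
    show "integrable lborel (\<lambda>s. C * \<bar>E s\<bar>)" using E by auto
    show "AE s in lborel. (\<lambda>n. k (u n - s) * E s) \<longlonglongrightarrow> k (t - s) * E s"
      using AE_lborel_singleton[of "t - d"]
    proof eventually_elim
      case (elim s)
      then have "isCont k (t - s)" by (intro cont) auto
      moreover have "(\<lambda>n. u n - s) \<longlonglongrightarrow> t - s" using u by (intro tendsto_intros)
      ultimately have "(\<lambda>n. k (u n - s)) \<longlonglongrightarrow> k (t - s)" by (rule isCont_tendsto_compose)
      then show ?case by (intro tendsto_intros)
    qed
    show "AE s in lborel. norm (k (u n - s) * E s) \<le> C * \<bar>E s\<bar>" for n
    proof (rule AE_I2)
      fix s
      show "norm (k (u n - s) * E s) \<le> C * \<bar>E s\<bar>"
      proof (cases "s \<le> 0")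
        case False
        then have "\<bar>k (u n - s)\<bar> \<le> C" using u(1)[rule_format, of n] by (intro k) auto
        then show ?thesis by (simp add: abs_mult mult_right_mono)
      qed (simp add: E0)
    qed
  qed auto
qed

text \<open>Dropping the part \<open>0 < x < d\<close> of the kernel leaves a bounded kernel, whose convolution is
continuous. On \<open>[a,T]\<close> the error is at most \<open>d\<^sup>\<nu> / \<Gamma>(\<nu> + 1)\<close> times a bound of \<open>g\<close> on
\<open>[a/2,T]\<close>, so the convergence as \<open>d \<rightarrow> 0\<close> is uniform there. Continuity thus comes from the
kernel alone, as it must for a derivative \<open>g = f'\<close> that is merely measurable and bounded by a power.\<close>

lemma continuous_on_frac_integral:
  assumes g: "admissible T g" and \<nu>: "0 < \<nu>"
  shows "continuous_on {0<..T} (frac_integral \<nu> g)"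
proof -
  note [measurable] = borel_measurable_integrable[OF admissible_integrable[OF g]]
  define E where "E = zero_ext T g"
  have Em [measurable]: "E \<in> borel_measurable borel" unfolding E_def by measurable
  define J where "J t = (LINT s|lborel. causal_kernel \<nu> (t - s) * E s)" for t
  define k where "k d x = (if d \<le> x then causal_kernel \<nu> x else 0)" for d x
  have km [measurable]: "k d \<in> borel_measurable borel" for d unfolding k_def[abs_def] by measurable
  have cont_k: "continuous_on {..T} (\<lambda>t. LINT s|lborel. k d (t - s) * E s)" if "0 < d" for d
  proof -
    obtain C where C: "0 \<le> C" "\<And>x. d \<le> x \<or> x \<le> 0 \<Longrightarrow> x \<le> T \<Longrightarrow> causal_kernel \<nu> x \<le> C"
      using causal_kernel_bounded[OF \<nu> \<open>0 < d\<close>, of T] by auto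
    show ?thesis
    proof (rule continuous_on_truncated_conv)
      show "\<bar>k d x\<bar> \<le> C" if "x \<le> T" for x
        using C that causal_kernel_nonneg[OF \<nu>, of x] by (auto simp: k_def)
      show "isCont (k d) x" if "x \<noteq> d" for x
      proof (cases "d < x")
        case True
        then have "\<forall>\<^sub>F y in nhds x. k d y = causal_kernel \<nu> y"
          using eventually_nhds_in_open[of "{d<..}" x] by (auto simp: k_def elim!: eventually_mono)
        then show ?thesis using causal_kernel_continuous_at[of x \<nu>] True \<open>0 < d\<close> by (simp add: isCont_cong)
      next
        case False
        then have "\<forall>\<^sub>F y in nhds x. k d y = 0"
          using eventually_nhds_in_open[of "{..<d}" x] that by (auto simp: k_def elim!: eventually_mono)
        then show ?thesis by (simp add: isCont_cong)
      qed
    qed (use admissible_integrable[OF g] in \<open>simp_all add: E_def, simp add: zero_ext_def\<close>)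
  qed
  have "continuous_on {a..T} J" if "0 < a" for a
  proof (rule uniform_limit_theorem)
    show "\<forall>\<^sub>F d in at_right 0. continuous_on {a..T} (\<lambda>t. LINT s|lborel. k d (t - s) * E s)"
      using eventually_at_right_less[of "0::real"]
      by eventually_elim (rule continuous_on_subset[OF cont_k], auto)
    obtain M where M: "0 \<le> M" "\<And>s. a / 2 \<le> s \<Longrightarrow> \<bar>E s\<bar> \<le> M"
      using admissible_bounded[OF g, of "a / 2"] \<open>0 < a\<close> unfolding E_def by auto
    show "uniform_limit {a..T} (\<lambda>d t. LINT s|lborel. k d (t - s) * E s) J (at_right 0)"
    proof (rule uniform_limitI)
      fix e :: real assume "0 < e"
      have "((\<lambda>d. M * (d powr \<nu> / Gamma (\<nu> + 1))) \<longlongrightarrow> M * (0 powr \<nu> / Gamma (\<nu> + 1))) (at_right 0)"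
        using \<nu> Gamma_real_pos[of "\<nu> + 1", THEN less_imp_neq] eventually_at_right_less[of "0::real"]
        by (intro tendsto_intros tendsto_powr') (auto elim!: eventually_mono intro!: tendsto_eq_intros)
      then have "\<forall>\<^sub>F d in at_right 0. M * (d powr \<nu> / Gamma (\<nu> + 1)) < e"
        by (rule order_tendstoD) (use \<open>0 < e\<close> in simp)
      moreover have "\<forall>\<^sub>F d in at_right 0. d < a / 2"
        using \<open>0 < a\<close> by (intro order_tendstoD[OF tendsto_ident_at]) auto
      ultimately show "\<forall>\<^sub>F d in at_right 0. \<forall>t\<in>{a..T}. dist (LINT s|lborel. k d (t - s) * E s) (J t) < e"
        using eventually_at_right_less[of "0::real"]
      proof eventually_elim
        case (elim d)
        show ?case
        proof
          fix t assume t: "t \<in> {a..T}"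
          have i1: "integrable lborel (\<lambda>s. causal_kernel \<nu> (t - s) * E s)"
            unfolding E_def using integrable_kernel_times[OF g \<nu>] t by auto
          then have i2: "integrable lborel (\<lambda>s. k d (t - s) * E s)"
            by (rule Bochner_Integration.integrable_bound) (auto simp: k_def)
          \<comment> \<open>The kernel of order 1 is the indicator of \<open>s > t - d\<close>, the range where the truncation bites.\<close>
          have i3: "integrable lborel (\<lambda>s. M * (causal_kernel \<nu> (t - s) * causal_kernel 1 (s - (t - d))))"
            using causal_kernel_conv_integrable(1)[OF \<nu>, of 1 t "t - d"] by auto
          have "dist (LINT s|lborel. k d (t - s) * E s) (J t)
              = norm (LINT s|lborel. causal_kernel \<nu> (t - s) * E s - k d (t - s) * E s)"
            unfolding J_def dist_norm by (simp add: i1 i2 norm_minus_commute)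
          also have "\<dots> \<le> (LINT s|lborel. M * (causal_kernel \<nu> (t - s) * causal_kernel 1 (s - (t - d))))"
          proof (rule Bochner_Integration.integral_norm_bound_integral)
            fix s
            show "norm (causal_kernel \<nu> (t - s) * E s - k d (t - s) * E s)
                \<le> M * (causal_kernel \<nu> (t - s) * causal_kernel 1 (s - (t - d)))"
            proof (cases "d \<le> t - s")
              case True
              then show ?thesis by (simp add: k_def causal_kernel_1)
            next
              case False
              then have "\<bar>E s\<bar> \<le> M" using t elim by (intro M(2)) auto
              then show ?thesis using False causal_kernel_nonneg[OF \<nu>, of "t - s"]
                by (simp add: k_def causal_kernel_1 abs_mult mult.commute mult_right_mono)
            qed
          qed (use i1 i2 i3 in auto)
          also have "\<dots> = M * causal_kernel (\<nu> + 1) d"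
            using causal_kernel_conv_integrable(2)[OF \<nu>, of 1 t "t - d"] by simp
          also have "\<dots> = M * (d powr \<nu> / Gamma (\<nu> + 1))"
            using elim by (simp add: causal_kernel_def frac_kernel_def)
          finally show "dist (LINT s|lborel. k d (t - s) * E s) (J t) < e" using elim by linarith
        qed
      qed
    qed
  qed (rule trivial_limit_at_right_real)
  then have J: "continuous_on {a..T} J" if "0 < a" for a
    using that .
  have "continuous_on {0<..T} J"
    unfolding continuous_on_eq_continuous_within
  proof
    fix t assume t: "t \<in> {0<..T}"
    have "at t within {0<..T} = at t within {t / 2..T}"
      by (rule at_within_nhd[of _ "{t / 2<..}"]) (use t in auto)
    then show "continuous (at t within {0<..T}) J"
      using J[of "t / 2"] t by (auto simp: continuous_on_eq_continuous_within)
  qed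
  then show ?thesis
    by (rule continuous_on_eq) (auto simp: J_def E_def frac_integral_eq_lborel[OF g \<nu>])
qed

section \<open>The semigroup law\<close>

lemma admissible_continuousI:
  assumes cont: "continuous_on {0<..T} g" and int: "integrable lborel (zero_ext T g)"
  shows "admissible T g"
  unfolding admissible_def
proof (intro conjI allI impI int)
  fix a :: real assume "0 < a"
  then have "compact (g ` {a..T})"
    by (intro compact_continuous_image continuous_on_subset[OF cont]) auto
  then have "bounded (g ` {a..T})" by (rule compact_imp_bounded)
  then show "\<exists>M. \<forall>t\<in>{a..T}. \<bar>g t\<bar> \<le> M" unfolding bounded_iff by auto
qed

lemma zero_ext_measurable:
  assumes "continuous_on {0<..T} g"
  shows "zero_ext T g \<in> borel_measurable borel"
proof -
  have "(\<lambda>s. indicator {0<..T} s *\<^sub>R g s) \<in> borel_measurable borel"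
    using assms by (intro borel_measurable_continuous_on_indicator) auto
  also have "(\<lambda>s. indicator {0<..T} s *\<^sub>R g s) = zero_ext T g"
    by (auto simp: zero_ext_def)
  finally show ?thesis .
qed

text \<open>Integrability on \<open>(0,T]\<close> is the case \<open>\<mu> = 1\<close>, \<open>t = T\<close> of integrability in the plane, as the kernel
of order 1 is the indicator of the positive half line.\<close>

lemma admissible_frac_integral:
  assumes g: "admissible T g" and \<nu>: "0 < \<nu>"
  shows "admissible T (frac_integral \<nu> g)"
proof (rule admissible_continuousI)
  note cont = continuous_on_frac_integral[OF g \<nu>]
  then show "continuous_on {0<..T} (frac_integral \<nu> g)" .
  have "integrable lborel (\<lambda>s. LINT r|lborel. causal_kernel 1 (T - s) * (causal_kernel \<nu> (s - r) * zero_ext T g r))"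
    using lborel_pair.integrable_fst'[OF integrable_kernel_plane[OF g, of 1 \<nu> T]] \<nu> by simp
  then show "integrable lborel (zero_ext T (frac_integral \<nu> g))"
  proof (rule integrable_cong_AE_imp)
    show "zero_ext T (frac_integral \<nu> g) \<in> borel_measurable lborel"
      using zero_ext_measurable[OF cont] by simp
    show "AE s in lborel. (LINT r|lborel. causal_kernel 1 (T - s) * (causal_kernel \<nu> (s - r) * zero_ext T g r))
            = zero_ext T (frac_integral \<nu> g) s"
      using AE_lborel_singleton[of T]
    proof eventually_elim
      case (elim s)
      consider "s \<le> 0" | "0 < s" "s < T" | "T < s" using elim by linarith
      then show ?case
      proof cases
        case 1
        then have "(\<lambda>r. causal_kernel 1 (T - s) * (causal_kernel \<nu> (s - r) * zero_ext T g r)) = (\<lambda>r. 0)"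
          by (auto simp: causal_kernel_def zero_ext_def)
        then show ?thesis using 1 by (simp add: zero_ext_def[of _ "frac_integral \<nu> g"])
      next
        case 2
        then show ?thesis
          by (simp add: causal_kernel_1 frac_integral_eq_lborel[OF g \<nu>] zero_ext_def[of _ "frac_integral \<nu> g"])
      next
        case 3
        then show ?thesis by (simp add: causal_kernel_1 zero_ext_def[of _ "frac_integral \<nu> g"])
      qed
    qed
  qed
qed

text \<open>Fubini's theorem moves the two kernels together, and the convolution of the kernels of order \<open>\<mu>\<close>
and \<open>\<nu>\<close> is the kernel of order \<open>\<mu> + \<nu>\<close>.\<close>

lemma frac_integral_semigroup:
  assumes g: "admissible T g" and \<mu>: "0 < \<mu>" and \<nu>: "0 < \<nu>" and t: "t \<in> {0..T}"
  shows "frac_integral \<mu> (frac_integral \<nu> g) t = frac_integral (\<mu> + \<nu>) g t"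
proof -
  have "frac_integral \<mu> (frac_integral \<nu> g) t
      = (LINT s|lborel. causal_kernel \<mu> (t - s) * zero_ext T (frac_integral \<nu> g) s)"
    using t by (intro frac_integral_eq_lborel admissible_frac_integral g \<mu> \<nu>) auto
  also have "\<dots> = (LINT s|lborel. LINT r|lborel. causal_kernel \<mu> (t - s) * (causal_kernel \<nu> (s - r) * zero_ext T g r))"
  proof (rule Bochner_Integration.integral_cong[OF refl])
    fix s
    consider "s \<le> 0" | "0 < s" "s \<le> T" | "t < s" using t by fastforce
    then show "causal_kernel \<mu> (t - s) * zero_ext T (frac_integral \<nu> g) s
        = (LINT r|lborel. causal_kernel \<mu> (t - s) * (causal_kernel \<nu> (s - r) * zero_ext T g r))"
    proof cases
      case 1
      then have "(\<lambda>r. causal_kernel \<mu> (t - s) * (causal_kernel \<nu> (s - r) * zero_ext T g r)) = (\<lambda>r. 0)"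
        by (auto simp: causal_kernel_def zero_ext_def)
      then show ?thesis using 1 by (simp add: zero_ext_def[of _ "frac_integral \<nu> g"])
    next
      case 2
      then show ?thesis
        by (simp add: frac_integral_eq_lborel[OF g \<nu>] zero_ext_def[of _ "frac_integral \<nu> g"])
    next
      case 3
      then show ?thesis by (simp add: causal_kernel_def[of \<mu>])
    qed
  qed
  also have "\<dots> = (LINT r|lborel. LINT s|lborel. causal_kernel \<mu> (t - s) * (causal_kernel \<nu> (s - r) * zero_ext T g r))"
    by (rule lborel_pair.Fubini_integral[OF integrable_kernel_plane[OF g \<mu> \<nu>], symmetric]) (use t in auto)
  also have "\<dots> = (LINT r|lborel. causal_kernel (\<mu> + \<nu>) (t - r) * zero_ext T g r)"
    by (simp only: mult.assoc[symmetric] integral_mult_left_zero causal_kernel_conv_integrable(2)[OF \<mu> \<nu>])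
  also have "\<dots> = frac_integral (\<mu> + \<nu>) g t"
    using t \<mu> \<nu> by (intro frac_integral_eq_lborel[symmetric] g) auto
  finally show ?thesis .
qed

section \<open>Linearity, comparison and power functions\<close>

lemma frac_integral_cong:
  assumes "\<And>s. s \<in> {0<..T} \<Longrightarrow> g s = h s" and "t \<in> {0..T}"
  shows "frac_integral \<nu> g t = frac_integral \<nu> h t"
  unfolding frac_integral_def conv_def
  by (rule integral_spike[of "{0}"]) (use assms in auto)

lemma admissible_cong:
  assumes g: "admissible T g" and eq: "\<And>s. s \<in> {0<..T} \<Longrightarrow> g s = h s"
  shows "admissible T h"
proof -
  have "\<exists>M. \<forall>t\<in>{a..T}. \<bar>h t\<bar> \<le> M" if a: "0 < a" for a
  proof -
    obtain M where "\<forall>t\<in>{a..T}. \<bar>g t\<bar> \<le> M"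
      using g a unfolding admissible_def by blast
    then have "\<forall>t\<in>{a..T}. \<bar>h t\<bar> \<le> M" using eq a by fastforce
    then show ?thesis ..
  qed
  moreover have "zero_ext T h = zero_ext T g" using eq by (auto simp: zero_ext_def)
  ultimately show ?thesis using g by (simp add: admissible_def)
qed

lemma zero_ext_add: "zero_ext T (\<lambda>t. g t + h t) s = zero_ext T g s + zero_ext T h s"
  and zero_ext_cmult: "zero_ext T (\<lambda>t. c * g t) s = c * zero_ext T g s"
  by (auto simp: zero_ext_def)

lemma admissible_add:
  assumes "admissible T g" "admissible T h"
  shows "admissible T (\<lambda>t. g t + h t)"
proof -
  have "\<exists>M. \<forall>t\<in>{a..T}. \<bar>g t + h t\<bar> \<le> M" if a: "0 < a" for a
  proof -
    obtain M N where "\<forall>t\<in>{a..T}. \<bar>g t\<bar> \<le> M" "\<forall>t\<in>{a..T}. \<bar>h t\<bar> \<le> N"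
      using assms a unfolding admissible_def by meson
    then have "\<forall>t\<in>{a..T}. \<bar>g t + h t\<bar> \<le> M + N" by (meson abs_triangle_ineq add_mono order_trans)
    then show ?thesis ..
  qed
  moreover have "integrable lborel (\<lambda>s. zero_ext T g s + zero_ext T h s)"
    using assms by (simp add: admissible_def)
  ultimately show ?thesis by (simp add: admissible_def zero_ext_add[abs_def])
qed

lemma admissible_cmult:
  assumes "admissible T g"
  shows "admissible T (\<lambda>t. c * g t)"
proof -
  have "\<exists>M. \<forall>t\<in>{a..T}. \<bar>c * g t\<bar> \<le> M" if a: "0 < a" for a
  proof -
    obtain M where "\<forall>t\<in>{a..T}. \<bar>g t\<bar> \<le> M"
      using assms a unfolding admissible_def by meson
    then have "\<forall>t\<in>{a..T}. \<bar>c * g t\<bar> \<le> \<bar>c\<bar> * M" by (simp add: abs_mult mult_left_mono)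
    then show ?thesis ..
  qed
  moreover have "integrable lborel (\<lambda>s. c * zero_ext T g s)"
    using assms by (simp add: admissible_def)
  ultimately show ?thesis by (simp add: admissible_def zero_ext_cmult[abs_def])
qed

lemma frac_integral_add:
  assumes g: "admissible T g" and h: "admissible T h" and \<nu>: "0 < \<nu>" and t: "t \<in> {0..T}"
  shows "frac_integral \<nu> (\<lambda>s. g s + h s) t = frac_integral \<nu> g t + frac_integral \<nu> h t"
proof -
  have t': "0 \<le> t" "t \<le> T" using t by auto
  show ?thesis
    using integrable_kernel_times[OF g \<nu> t'(2)] integrable_kernel_times[OF h \<nu> t'(2)]
    by (simp add: frac_integral_eq_lborel[OF admissible_add[OF g h] \<nu> t'] frac_integral_eq_lborel[OF g \<nu> t']
        frac_integral_eq_lborel[OF h \<nu> t'] zero_ext_add distrib_left)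
qed


lemma frac_integral_cmult: "frac_integral \<nu> (\<lambda>s. c * g s) t = c * frac_integral \<nu> g t"
proof -
  have "(\<lambda>s. frac_kernel \<nu> (t - s) * (c * g s)) = (\<lambda>s. c * (frac_kernel \<nu> (t - s) * g s))"
    by (simp only: mult.left_commute)
  then show ?thesis by (simp only: frac_integral_def conv_def integral_mult_right)
qed


lemma frac_integral_at_0: "frac_integral \<nu> g 0 = 0"
  unfolding frac_integral_def conv_def by (simp only: atLeastAtMost_singleton integral_singleton)


lemma admissible_frac_kernel:
  assumes \<mu>: "0 < \<mu>"
  shows "admissible T (frac_kernel \<mu>)"
proof (rule admissible_continuousI)
  show cont: "continuous_on {0<..T} (frac_kernel \<mu>)"
    unfolding frac_kernel_def[abs_def] divide_inverse by (intro continuous_intros) auto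
  have "integrable lborel (\<lambda>s. causal_kernel 1 (T - s) * causal_kernel \<mu> (s - 0))"
    using causal_kernel_conv_integrable(1)[OF _ \<mu>, of 1 T 0] by simp
  then show "integrable lborel (zero_ext T (frac_kernel \<mu>))"
  proof (rule integrable_cong_AE_imp)
    show "zero_ext T (frac_kernel \<mu>) \<in> borel_measurable lborel"
      using zero_ext_measurable[OF cont] by simp
    show "AE s in lborel. causal_kernel 1 (T - s) * causal_kernel \<mu> (s - 0) = zero_ext T (frac_kernel \<mu>) s"
      using AE_lborel_singleton[of T]
      by eventually_elim (auto simp: causal_kernel_1, auto simp: zero_ext_def causal_kernel_def)
  qed
qed

lemma frac_integral_frac_kernel:
  assumes \<nu>: "0 < \<nu>" and \<mu>: "0 < \<mu>" and t: "t \<in> {0<..T}"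
  shows "frac_integral \<nu> (frac_kernel \<mu>) t = frac_kernel (\<nu> + \<mu>) t"
proof -
  have "frac_integral \<nu> (frac_kernel \<mu>) t
      = (LINT s|lborel. causal_kernel \<nu> (t - s) * zero_ext T (frac_kernel \<mu>) s)"
    using t by (intro frac_integral_eq_lborel admissible_frac_kernel \<mu> \<nu>) auto
  also have "\<dots> = (LINT s|lborel. causal_kernel \<nu> (t - s) * causal_kernel \<mu> (s - 0))"
    by (intro Bochner_Integration.integral_cong refl) (use t in \<open>auto simp: causal_kernel_def zero_ext_def\<close>)
  also have "\<dots> = frac_kernel (\<nu> + \<mu>) t"
    using causal_kernel_conv_integrable(2)[OF \<nu> \<mu>, of t 0] t by (simp add: causal_kernel_def)
  finally show ?thesis .
qed

lemma abs_frac_integral_le: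
  assumes g: "admissible T g" and h: "admissible T h" and \<nu>: "0 < \<nu>" and t: "t \<in> {0..T}"
    and le: "\<And>s. s \<in> {0<..T} \<Longrightarrow> \<bar>g s\<bar> \<le> h s"
  shows "\<bar>frac_integral \<nu> g t\<bar> \<le> frac_integral \<nu> h t"
proof -
  have "norm (LINT s|lborel. causal_kernel \<nu> (t - s) * zero_ext T g s)
      \<le> (LINT s|lborel. causal_kernel \<nu> (t - s) * zero_ext T h s)"
  proof (rule Bochner_Integration.integral_norm_bound_integral)
    show "norm (causal_kernel \<nu> (t - s) * zero_ext T g s) \<le> causal_kernel \<nu> (t - s) * zero_ext T h s" for s
      using causal_kernel_nonneg[OF \<nu>, of "t - s"] le[of s]
      by (auto simp: zero_ext_def abs_mult intro: mult_left_mono)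
  qed (use t integrable_kernel_times g h \<nu> in auto)
  then show ?thesis using t by (simp add: frac_integral_eq_lborel[OF g \<nu>] frac_integral_eq_lborel[OF h \<nu>])
qed

section \<open>The integral of order one\<close>

lemma continuous_on_frac_integral_1:
  assumes g: "admissible T g"
  shows "continuous_on {0..T} (frac_integral 1 g)"
proof -
  have "continuous_on {..T} (\<lambda>t. LINT s|lborel. causal_kernel 1 (t - s) * zero_ext T g s)"
  proof (rule continuous_on_truncated_conv[where d = 0 and C = 1])
    show "integrable lborel (zero_ext T g)" using g by (rule admissible_integrable)
    show "isCont (causal_kernel 1) x" if "x \<noteq> 0" for x using that by (rule causal_kernel_continuous_at)
  qed (simp_all add: causal_kernel_1 zero_ext_def)
  then have "continuous_on {0..T} (\<lambda>t. LINT s|lborel. causal_kernel 1 (t - s) * zero_ext T g s)"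
    by (rule continuous_on_subset) auto
  then show ?thesis
    by (rule continuous_on_eq) (auto simp: frac_integral_eq_lborel[OF g])
qed

lemma frac_integral_1_diff:
  assumes g: "admissible T g" and "0 < a" "a \<le> t" "t \<le> T"
  shows "frac_integral 1 g t = frac_integral 1 g a + integral {a..t} g"
proof -
  note i = integrable_kernel_times[OF g, of 1]
  have "frac_integral 1 g t - frac_integral 1 g a
      = (LINT s|lborel. causal_kernel 1 (t - s) * zero_ext T g s - causal_kernel 1 (a - s) * zero_ext T g s)"
    using assms i[of t] i[of a] by (simp add: frac_integral_eq_lborel[OF g])
  also have "\<dots> = integral UNIV (\<lambda>s. causal_kernel 1 (t - s) * zero_ext T g s - causal_kernel 1 (a - s) * zero_ext T g s)"
    using assms i[of t] i[of a] by (intro integral_lborel[symmetric]) auto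
  also have "\<dots> = integral UNIV (\<lambda>s. if s \<in> {a..t} then g s else 0)"
    by (rule integral_spike[of "{a, t}"]) (use assms in \<open>auto simp: causal_kernel_1 zero_ext_def\<close>)
  also have "\<dots> = integral {a..t} g" unfolding integral_restrict_UNIV ..
  finally show ?thesis by simp
qed

lemma frac_integral_1_has_derivative:
  assumes g: "admissible T g" and cont: "continuous_on {0<..T} g" and t: "t \<in> {0<..T}"
  shows "(frac_integral 1 g has_real_derivative g t) (at t within {0<..T})"
proof -
  have "((\<lambda>u. integral {t / 2..u} g) has_vector_derivative g t) (at t within {t / 2..T})"
    using t by (intro integral_has_vector_derivative continuous_on_subset[OF cont]) auto
  from has_vector_derivative_add[OF has_vector_derivative_const this]
  have "((\<lambda>u. frac_integral 1 g (t / 2) + integral {t / 2..u} g) has_vector_derivative g t) (at t within {t / 2..T})"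
    by simp
  then have "(frac_integral 1 g has_vector_derivative g t) (at t within {t / 2..T})"
  proof (rule has_vector_derivative_transform[rotated 2])
    show "t \<in> {t / 2..T}" using t by simp
    show "frac_integral 1 g u = frac_integral 1 g (t / 2) + integral {t / 2..u} g" if "u \<in> {t / 2..T}" for u
      by (rule frac_integral_1_diff[OF g]) (use t that in simp_all)
  qed
  moreover have "at t within {0<..T} = at t within {t / 2..T}"
    by (rule at_within_nhd[of _ "{t / 2<..}"]) (use t in auto)
  ultimately show ?thesis by (simp add: has_real_derivative_iff_has_vector_derivative)
qed

lemma deriv_upto_eqI:
  assumes "(F has_real_derivative D) (at t within {0<..T})" "t \<in> {0<..T}"
  shows "deriv_upto T F t = D"
  unfolding deriv_upto_def
  using assms by (intro vector_derivative_within)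
    (simp_all add: trivial_limit_within has_real_derivative_iff_has_vector_derivative)

text \<open>Continuity makes both functions the pointwise derivative of the same primitive. This is how the factor
\<open>I\<^sup>1\<close> is cancelled from the Volterra equations.\<close>

lemma frac_integral_1_inject:
  assumes g: "admissible T g" "continuous_on {0<..T} g" and h: "admissible T h" "continuous_on {0<..T} h"
    and eq: "\<And>t. t \<in> {0<..T} \<Longrightarrow> frac_integral 1 g t = frac_integral 1 h t" and t: "t \<in> {0<..T}"
  shows "g t = h t"
proof -
  have "(frac_integral 1 g has_real_derivative h t) (at t within {0<..T})"
    using frac_integral_1_has_derivative[OF h t] unfolding has_real_derivative_iff_has_vector_derivative
    by (rule has_vector_derivative_transform[rotated 2]) (use t eq in auto)
  then have "deriv_upto T (frac_integral 1 g) t = h t" using t by (rule deriv_upto_eqI)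
  moreover have "deriv_upto T (frac_integral 1 g) t = g t"
    using frac_integral_1_has_derivative[OF g t] t by (rule deriv_upto_eqI)
  ultimately show ?thesis by simp
qed

lemma admissible_abs:
  assumes "admissible T g"
  shows "admissible T (\<lambda>t. \<bar>g t\<bar>)"
proof -
  have "zero_ext T (\<lambda>t. \<bar>g t\<bar>) = (\<lambda>s. \<bar>zero_ext T g s\<bar>)" by (auto simp: zero_ext_def)
  then show ?thesis using assms by (simp add: admissible_def)
qed

text \<open>A kernel of order at least 1 is nondecreasing, hence bounded on \<open>[0,t]\<close> by its value at \<open>t\<close>. This gives
pointwise control from the mere integrability of \<open>g\<close>.\<close>

lemma abs_frac_integral_le_frac_integral_1:
  assumes g: "admissible T g" and \<nu>: "1 \<le> \<nu>" and t: "t \<in> {0..T}"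
  shows "\<bar>frac_integral \<nu> g t\<bar> \<le> frac_kernel \<nu> t * frac_integral 1 (\<lambda>s. \<bar>g s\<bar>) t"
proof -
  have \<nu>0: "0 < \<nu>" using \<nu> by simp
  have t': "0 \<le> t" "t \<le> T" using t by auto
  have G: "0 < Gamma \<nu>" using \<nu>0 by auto
  note h = admissible_abs[OF g]
  have "norm (LINT s|lborel. causal_kernel \<nu> (t - s) * zero_ext T g s)
      \<le> (LINT s|lborel. frac_kernel \<nu> t * (causal_kernel 1 (t - s) * zero_ext T (\<lambda>s. \<bar>g s\<bar>) s))"
  proof (rule Bochner_Integration.integral_norm_bound_integral)
    fix s
    show "norm (causal_kernel \<nu> (t - s) * zero_ext T g s)
        \<le> frac_kernel \<nu> t * (causal_kernel 1 (t - s) * zero_ext T (\<lambda>s. \<bar>g s\<bar>) s)"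
    proof (cases "0 < s \<and> s < t")
      case True
      then have "(t - s) powr (\<nu> - 1) \<le> t powr (\<nu> - 1)" using \<nu> by (intro powr_mono2) auto
      then have "causal_kernel \<nu> (t - s) \<le> frac_kernel \<nu> t"
        using True G by (simp add: causal_kernel_def frac_kernel_def divide_right_mono)
      then show ?thesis using True t' causal_kernel_nonneg[OF \<nu>0, of "t - s"]
        by (simp add: abs_mult mult_right_mono zero_ext_def causal_kernel_1)
    next
      case False
      then show ?thesis by (auto simp: causal_kernel_def zero_ext_def)
    qed
  qed (use integrable_kernel_times[OF g \<nu>0 t'(2)] integrable_kernel_times[OF h zero_less_one t'(2)] in simp_all)
  then show ?thesis
    by (simp add: frac_integral_eq_lborel[OF g \<nu>0 t'] frac_integral_eq_lborel[OF h zero_less_one t'])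
qed

lemma frac_integral_1_bounded:
  assumes "admissible T g"
  obtains B where "0 \<le> B" "\<And>t. t \<in> {0..T} \<Longrightarrow> \<bar>frac_integral 1 g t\<bar> \<le> B"
proof -
  have "compact (frac_integral 1 g ` {0..T})"
    by (intro compact_continuous_image continuous_on_frac_integral_1 assms) auto
  then have "bounded (frac_integral 1 g ` {0..T})" by (rule compact_imp_bounded)
  then obtain B where "\<forall>t\<in>{0..T}. \<bar>frac_integral 1 g t\<bar> \<le> B" unfolding bounded_iff by auto
  then show ?thesis by (intro that[of "max B 0"]) (simp_all add: le_max_iff_disj)
qed

section \<open>Powers of the operator in the right-hand side\<close>

lemma admissible_neg_frac_op:
  "admissible T g \<Longrightarrow> 0 < \<alpha> \<Longrightarrow> admissible T (neg_frac_op \<alpha> lam g)"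
  unfolding neg_frac_op_def by (intro admissible_cmult admissible_frac_integral)

lemma admissible_neg_frac_op_funpow:
  "admissible T g \<Longrightarrow> 0 < \<alpha> \<Longrightarrow> admissible T ((neg_frac_op \<alpha> lam ^^ i) g)"
  by (induction i) (simp_all add: admissible_neg_frac_op)

lemma continuous_on_neg_frac_op:
  "admissible T g \<Longrightarrow> 0 < \<alpha> \<Longrightarrow> continuous_on {0<..T} (neg_frac_op \<alpha> lam g)"
  unfolding neg_frac_op_def by (intro continuous_intros continuous_on_frac_integral)

lemma continuous_on_neg_frac_op_funpow:
  assumes "admissible T g" "0 < \<alpha>" "continuous_on {0<..T} g"
  shows "continuous_on {0<..T} ((neg_frac_op \<alpha> lam ^^ i) g)"
  using assms
  by (cases i) (simp_all add: continuous_on_neg_frac_op admissible_neg_frac_op_funpow)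

lemma neg_frac_op_cong:
  assumes "\<And>s. s \<in> {0<..T} \<Longrightarrow> g s = h s" "t \<in> {0..T}"
  shows "neg_frac_op \<alpha> lam g t = neg_frac_op \<alpha> lam h t"
  using frac_integral_cong[of T g h t \<alpha>] assms by (simp add: neg_frac_op_def)

lemma neg_frac_op_funpow_cong:
  assumes "\<And>s. s \<in> {0<..T} \<Longrightarrow> g s = h s" "t \<in> {0<..T}"
  shows "(neg_frac_op \<alpha> lam ^^ i) g t = (neg_frac_op \<alpha> lam ^^ i) h t"
  using assms(2)
proof (induction i arbitrary: t)
  case (Suc i)
  then have "neg_frac_op \<alpha> lam ((neg_frac_op \<alpha> lam ^^ i) g) t = neg_frac_op \<alpha> lam ((neg_frac_op \<alpha> lam ^^ i) h) t"
    by (intro neg_frac_op_cong[of T]) simp_all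
  then show ?case by simp
qed (simp add: assms(1))

lemma neg_frac_op_frac_integral:
  assumes "admissible T g" "0 < \<alpha>" "0 < \<nu>" "t \<in> {0..T}"
  shows "neg_frac_op \<alpha> lam (frac_integral \<nu> g) t = frac_integral \<nu> (neg_frac_op \<alpha> lam g) t"
  unfolding neg_frac_op_def frac_integral_cmult
  using frac_integral_semigroup[OF assms(1-3,4)] frac_integral_semigroup[OF assms(1,3,2,4)]
  by (simp add: add.commute)

lemma neg_frac_op_funpow_frac_integral:
  assumes g: "admissible T g" and \<alpha>: "0 < \<alpha>" and \<nu>: "0 < \<nu>" and t: "t \<in> {0<..T}"
  shows "(neg_frac_op \<alpha> lam ^^ i) (frac_integral \<nu> g) t = frac_integral \<nu> ((neg_frac_op \<alpha> lam ^^ i) g) t"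
  using t
proof (induction i arbitrary: t)
  case (Suc i)
  have "(neg_frac_op \<alpha> lam ^^ Suc i) (frac_integral \<nu> g) t
      = neg_frac_op \<alpha> lam (frac_integral \<nu> ((neg_frac_op \<alpha> lam ^^ i) g)) t"
    unfolding funpow.simps comp_def by (rule neg_frac_op_cong[of T]) (use Suc in simp_all)
  also have "\<dots> = frac_integral \<nu> ((neg_frac_op \<alpha> lam ^^ Suc i) g) t"
    unfolding funpow.simps comp_def
    by (rule neg_frac_op_frac_integral[OF admissible_neg_frac_op_funpow[OF g \<alpha>] \<alpha> \<nu>]) (use Suc.prems in simp)
  finally show ?case .
qed simp

lemma neg_frac_op_linear:
  assumes "admissible T g" "admissible T h" "0 < \<alpha>" "t \<in> {0..T}"
  shows "neg_frac_op \<alpha> lam (\<lambda>t. g t + c * h t) t = neg_frac_op \<alpha> lam g t + c * neg_frac_op \<alpha> lam h t"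
  using frac_integral_add[OF assms(1) admissible_cmult[OF assms(2)] assms(3,4), of c]
  by (simp add: neg_frac_op_def frac_integral_cmult algebra_simps)

lemma neg_frac_op_funpow_linear:
  assumes "admissible T g" "admissible T h" "0 < \<alpha>" "t \<in> {0<..T}"
  shows "(neg_frac_op \<alpha> lam ^^ i) (\<lambda>t. g t + c * h t) t
       = (neg_frac_op \<alpha> lam ^^ i) g t + c * (neg_frac_op \<alpha> lam ^^ i) h t"
  using assms(4)
proof (induction i arbitrary: t)
  case (Suc i)
  let ?A = "neg_frac_op \<alpha> lam"
  have "(?A ^^ Suc i) (\<lambda>t. g t + c * h t) t = ?A (\<lambda>t. (?A ^^ i) g t + c * (?A ^^ i) h t) t"
    unfolding funpow.simps comp_def by (rule neg_frac_op_cong[of T]) (use Suc in simp_all)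
  also have "\<dots> = (?A ^^ Suc i) g t + c * (?A ^^ Suc i) h t"
    using Suc.prems assms by (simp add: neg_frac_op_linear[of T] admissible_neg_frac_op_funpow)
  finally show ?case .
qed simp

lemma frac_integral_neg_frac_op_funpow:
  assumes g: "admissible T g" and \<alpha>: "0 < \<alpha>" and "0 < \<nu>" and t: "t \<in> {0..T}"
  shows "frac_integral \<nu> ((neg_frac_op \<alpha> lam ^^ i) g) t = (- lam) ^ i * frac_integral (\<nu> + real i * \<alpha>) g t"
  using assms(3)
proof (induction i arbitrary: \<nu>)
  case (Suc i)
  have "frac_integral \<nu> ((neg_frac_op \<alpha> lam ^^ Suc i) g) t
      = - lam * frac_integral \<nu> (frac_integral \<alpha> ((neg_frac_op \<alpha> lam ^^ i) g)) t"
    unfolding funpow.simps comp_def neg_frac_op_def[of _ _ "(neg_frac_op \<alpha> lam ^^ i) g"] frac_integral_cmult ..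
  also have "\<dots> = - lam * frac_integral (\<nu> + \<alpha>) ((neg_frac_op \<alpha> lam ^^ i) g) t"
    using frac_integral_semigroup[OF admissible_neg_frac_op_funpow[OF g \<alpha>] Suc.prems \<alpha> t] by simp
  also have "\<dots> = (- lam) ^ Suc i * frac_integral (\<nu> + real (Suc i) * \<alpha>) g t"
    using Suc.IH[of "\<nu> + \<alpha>"] Suc.prems \<alpha> by (simp add: algebra_simps)
  finally show ?case .
qed simp

section \<open>Solutions and their densities\<close>

text \<open>The fundamental theorem of calculus, with the singularity of the derivative at 0 absorbed by the
continuity of \<open>w\<close> there, recovers \<open>w\<close> from its derivative.\<close>

lemma frac_solution_density:
  assumes sol: "frac_solution T \<alpha> lam g w"
  defines "p \<equiv> deriv_upto T w"
  shows "admissible T p" "continuous_on {0<..T} p"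
    and "\<And>t. t \<in> {0..T} \<Longrightarrow> w t = frac_integral 1 p t"
    and "\<And>t. t \<in> {0<..T} \<Longrightarrow> frac_integral (1 - \<alpha>) p t + lam * frac_integral 1 p t = g t"
proof -
  have w: "continuous_on {0..T} w" "w differentiable_on {0<..T}" "w 0 = 0"
    and p: "continuous_on {0<..T} p" "p absolutely_integrable_on {0<..T}"
    and eq: "\<And>t. t \<in> {0<..T} \<Longrightarrow> frac_integral (1 - \<alpha>) p t + lam * w t = g t"
    using sol by (auto simp: frac_solution_def p_def frac_deriv_def)
  show "continuous_on {0<..T} p" by fact
  have "integrable lebesgue (zero_ext T p)"
  proof -
    have "(\<lambda>s. indicator {0<..T} s *\<^sub>R p s) = zero_ext T p" by (auto simp: zero_ext_def)
    then show ?thesis using p(2) by (simp add: set_integrable_def)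
  qed
  then have "integrable lborel (zero_ext T p)"
    using zero_ext_measurable[OF p(1)] by (simp add: integrable_completion)
  then show "admissible T p" by (rule admissible_continuousI[OF p(1)])
  show *: "w t = frac_integral 1 p t" if t: "t \<in> {0..T}" for t
  proof -
    have "(p has_integral w t - w 0) {0..t}"
    proof (rule fundamental_theorem_of_calculus_interior)
      show "continuous_on {0..t} w" using w(1) by (rule continuous_on_subset) (use t in auto)
      fix x assume x: "x \<in> {0<..<t}"
      have "w differentiable (at x within {0<..T})"
        using w(2) x t by (auto simp: differentiable_on_def)
      then have "(w has_vector_derivative p x) (at x within {0<..T})"
        by (simp add: vector_derivative_works p_def deriv_upto_def)
      moreover have "at x within {0<..T} = at x"
        by (rule at_within_nhd[of x "{0<..<T}"]) (use x t in auto)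
      ultimately show "(w has_vector_derivative p x) (at x)" by simp
    qed (use t in auto)
    then have "w t = integral {0..t} p" using w(3) by (simp add: integral_unique)
    also have "\<dots> = frac_integral 1 p t"
      unfolding frac_integral_def conv_def
      by (rule integral_spike[of "{t}"]) (auto simp: frac_kernel_def)
    finally show ?thesis .
  qed
  show "frac_integral (1 - \<alpha>) p t + lam * frac_integral 1 p t = g t" if "t \<in> {0<..T}" for t
    using eq[OF that] *[of t] that by simp
qed

lemma frac_integral_1_has_derivative_transfer:
  assumes "admissible T p" "continuous_on {0<..T} p" and t: "t \<in> {0<..T}"
    and w: "\<And>t. t \<in> {0<..T} \<Longrightarrow> w t = frac_integral 1 p t"
  shows "(w has_real_derivative p t) (at t within {0<..T})"
  using frac_integral_1_has_derivative[OF assms(1-3)] unfolding has_real_derivative_iff_has_vector_derivative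
  by (rule has_vector_derivative_transform[rotated 2]) (use t w in simp_all)

text \<open>Converse of \<open>frac_solution_density\<close>: the two together say that solutions correspond to continuous
admissible densities \<open>p\<close> that satisfy an integral equation.\<close>

lemma frac_solutionI:
  assumes p: "admissible T p" "continuous_on {0<..T} p" and "0 < T"
    and w: "\<And>t. t \<in> {0..T} \<Longrightarrow> w t = frac_integral 1 p t"
    and eq: "\<And>t. t \<in> {0<..T} \<Longrightarrow> frac_integral (1 - \<alpha>) p t + lam * frac_integral 1 p t = g t"
  shows "frac_solution T \<alpha> lam g w"
  unfolding frac_solution_def
proof (intro conjI ballI)
  have der: "(w has_real_derivative p t) (at t within {0<..T})" if "t \<in> {0<..T}" for t
    by (rule frac_integral_1_has_derivative_transfer[OF p that]) (simp add: w)
  then have dp: "deriv_upto T w t = p t" if "t \<in> {0<..T}" for t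
    using that by (intro deriv_upto_eqI) auto
  show "continuous_on {0..T} w"
    by (rule continuous_on_eq[OF continuous_on_frac_integral_1[OF p(1)]]) (simp add: w)
  show "w differentiable_on {0<..T}"
    unfolding differentiable_on_def using der real_differentiable_def by blast
  show "continuous_on {0<..T} (deriv_upto T w)"
    by (rule continuous_on_eq[OF p(2)]) (simp add: dp)
  show "deriv_upto T w absolutely_integrable_on {0<..T}"
  proof -
    have "(\<lambda>s. indicator {0<..T} s *\<^sub>R deriv_upto T w s) = zero_ext T p"
      using dp by (auto simp: zero_ext_def)
    moreover have "integrable lebesgue (zero_ext T p)"
      using admissible_integrable[OF p(1)] by (simp add: integrable_completion)
    ultimately show ?thesis by (simp add: set_integrable_def)
  qed
  show "frac_deriv T \<alpha> w t + lam * w t = g t" if t: "t \<in> {0<..T}" for t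
  proof -
    have "frac_deriv T \<alpha> w t = frac_integral (1 - \<alpha>) p t"
      unfolding frac_deriv_def by (rule frac_integral_cong[of T]) (use dp t in auto)
    then show ?thesis using eq[OF t] w[of t] t by simp
  qed
  show "w 0 = 0" using w[of 0] \<open>0 < T\<close> by (simp add: frac_integral_at_0)
qed

section \<open>The Volterra equation and uniqueness\<close>

text \<open>Iterating \<open>q = A q\<close> until the order \<open>\<nu>\<close> of the integral reaches 1 gives a kernel without singularity,
hence \<open>\<bar>q\<bar> \<le> K I\<^sup>1 \<bar>q\<bar>\<close>. This is Gronwall's situation: \<open>j\<close> further iterations
bound \<open>\<bar>q\<bar>\<close> by a constant times \<open>(K t)\<^sup>j / j!\<close>, which tends to 0.\<close>

lemma volterra_homogeneous_zero:
  assumes q: "admissible T q" and \<alpha>: "0 < \<alpha>"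
    and fix_q: "\<And>t. t \<in> {0<..T} \<Longrightarrow> q t = neg_frac_op \<alpha> lam q t"
    and t: "t \<in> {0<..T}"
  shows "q t = 0"
proof -
  let ?A = "neg_frac_op \<alpha> lam"
  have iter: "q t = (?A ^^ i) q t" if "t \<in> {0<..T}" for i t
    using that
  proof (induction i arbitrary: t)
    case (Suc i)
    then show ?case using fix_q[of t] neg_frac_op_cong[of T q "(?A ^^ i) q" t \<alpha> lam] by simp
  qed simp
  obtain m :: nat where m: "1 / \<alpha> < real m" using reals_Archimedean2 by blast
  define \<nu> where "\<nu> = \<alpha> + real m * \<alpha>"
  have \<nu>: "1 \<le> \<nu>" using m \<alpha> by (simp add: \<nu>_def field_simps)
  define K where "K = \<bar>lam\<bar> ^ Suc m * frac_kernel \<nu> T"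
  have K: "0 \<le> K" using \<nu> by (simp add: K_def frac_kernel_def)
  note aq = admissible_abs[OF q]
  have le: "\<bar>q t\<bar> \<le> K * frac_integral 1 (\<lambda>s. \<bar>q s\<bar>) t" if t: "t \<in> {0<..T}" for t
  proof -
    have t': "t \<in> {0..T}" using t by simp
    have "q t = - lam * frac_integral \<alpha> ((?A ^^ m) q) t"
      using iter[OF t, of "Suc m"] by (simp add: neg_frac_op_def[of _ _ "(?A ^^ m) q"])
    also have "\<dots> = (- lam) ^ Suc m * frac_integral \<nu> q t"
      by (simp add: frac_integral_neg_frac_op_funpow[OF q \<alpha> \<alpha> t'] \<nu>_def)
    finally have "\<bar>q t\<bar> = \<bar>lam\<bar> ^ Suc m * \<bar>frac_integral \<nu> q t\<bar>"
      by (simp add: abs_mult power_abs)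
    also have "\<dots> \<le> \<bar>lam\<bar> ^ Suc m * (frac_kernel \<nu> t * frac_integral 1 (\<lambda>s. \<bar>q s\<bar>) t)"
      using abs_frac_integral_le_frac_integral_1[OF q \<nu> t'] by (intro mult_left_mono) auto
    also have "\<dots> \<le> \<bar>lam\<bar> ^ Suc m * (frac_kernel \<nu> T * frac_integral 1 (\<lambda>s. \<bar>q s\<bar>) t)"
    proof (intro mult_left_mono mult_right_mono)
      show "frac_kernel \<nu> t \<le> frac_kernel \<nu> T"
        using t \<nu> by (auto simp: frac_kernel_def intro!: divide_right_mono powr_mono2)
      show "0 \<le> frac_integral 1 (\<lambda>s. \<bar>q s\<bar>) t"
        using abs_frac_integral_le[OF q aq _ t', of 1] by simp
    qed simp
    finally show ?thesis by (simp add: K_def mult.assoc)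
  qed
  obtain B where B: "0 \<le> B" "\<And>t. t \<in> {0..T} \<Longrightarrow> \<bar>frac_integral 1 (\<lambda>s. \<bar>q s\<bar>) t\<bar> \<le> B"
    using frac_integral_1_bounded[OF aq] by blast
  have bound: "\<bar>q t\<bar> \<le> K ^ j * (K * B) * frac_kernel (real j + 1) t" if "t \<in> {0<..T}" for j t
    using that
  proof (induction j arbitrary: t)
    case 0
    have "\<bar>q t\<bar> \<le> K * frac_integral 1 (\<lambda>s. \<bar>q s\<bar>) t" using le[OF 0] .
    also have "\<dots> \<le> K * B" using K B(2)[of t] 0 by (intro mult_left_mono) auto
    finally show ?case using 0 by (simp add: frac_kernel_def)
  next
    case (Suc j)
    let ?h = "\<lambda>s. K ^ j * (K * B) * frac_kernel (real j + 1) s"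
    have "frac_integral 1 (\<lambda>s. \<bar>q s\<bar>) t \<le> frac_integral 1 ?h t"
    proof -
      have "\<bar>frac_integral 1 (\<lambda>s. \<bar>q s\<bar>) t\<bar> \<le> frac_integral 1 ?h t"
        by (rule abs_frac_integral_le[OF aq admissible_cmult[OF admissible_frac_kernel]])
           (use Suc in auto)
      then show ?thesis by simp
    qed
    also have "\<dots> = K ^ j * (K * B) * frac_kernel (real (Suc j) + 1) t"
    proof -
      have "frac_integral 1 (frac_kernel (real j + 1)) t = frac_kernel (1 + (real j + 1)) t"
        using Suc.prems by (intro frac_integral_frac_kernel[of _ _ _ T]) auto
      also have "1 + (real j + 1) = real (Suc j) + 1" by simp
      finally show ?thesis by (simp only: frac_integral_cmult)
    qed
    finally have "\<bar>q t\<bar> \<le> K * (K ^ j * (K * B) * frac_kernel (real (Suc j) + 1) t)"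
      using le[OF Suc.prems] K by (meson mult_left_mono order_trans)
    then show ?case by (simp add: mult_ac)
  qed
  have "(\<lambda>j. (K * B) * (inverse (fact j) * (K * t) ^ j)) \<longlonglongrightarrow> (K * B) * 0"
    by (intro tendsto_intros summable_LIMSEQ_zero summable_exp)
  moreover have "\<bar>q t\<bar> \<le> (K * B) * (inverse (fact j) * (K * t) ^ j)" for j
    using bound[OF t, of j] t
    by (simp add: frac_kernel_def powr_realpow Gamma_fact[of j, where 'a = real] power_mult_distrib
                  field_simps add.commute)
  ultimately have "\<bar>q t\<bar> \<le> K * B * 0" by (intro LIMSEQ_le_const) auto
  then show ?thesis by simp
qed

text \<open>Since \<open>I\<^sup>\<alpha> I\<^sup>1\<^sup>-\<^sup>\<alpha> = I\<^sup>1\<close> and \<open>I\<^sup>\<alpha> I\<^sup>1 = I\<^sup>1 I\<^sup>\<alpha>\<close>, applying \<open>I\<^sup>\<alpha>\<close> to the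
equation makes both terms on the left a multiple of \<open>I\<^sup>1\<close>.\<close>

lemma volterra_equation:
  assumes p: "admissible T p" and \<alpha>: "0 < \<alpha>" "\<alpha> < 1"
    and eq: "\<And>t. t \<in> {0<..T} \<Longrightarrow> frac_integral (1 - \<alpha>) p t + lam * frac_integral 1 p t = g t"
    and t: "t \<in> {0..T}"
  shows "frac_integral \<alpha> g t = frac_integral 1 (\<lambda>s. p s + - 1 * neg_frac_op \<alpha> lam p s) t"
proof -
  have "frac_integral \<alpha> g t = frac_integral \<alpha> (\<lambda>s. frac_integral (1 - \<alpha>) p s + lam * frac_integral 1 p s) t"
    by (rule frac_integral_cong[of T]) (use eq t in auto)
  also have "\<dots> = frac_integral 1 p t + lam * frac_integral (\<alpha> + 1) p t"
    using \<alpha> t by (simp add: frac_integral_add[of T] admissible_cmult admissible_frac_integral p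
        frac_integral_cmult frac_integral_semigroup[of T])
  also have "\<dots> = frac_integral 1 p t + lam * frac_integral 1 (frac_integral \<alpha> p) t"
    using \<alpha> t by (simp add: frac_integral_semigroup[of T] p add.commute)
  also have "\<dots> = frac_integral 1 (\<lambda>s. p s + lam * frac_integral \<alpha> p s) t"
    using \<alpha> t by (simp add: frac_integral_add[of T] admissible_cmult admissible_frac_integral p
        frac_integral_cmult)
  finally show ?thesis by (simp add: neg_frac_op_def)
qed

lemma density_unique:
  assumes p: "admissible T p" "continuous_on {0<..T} p" and q: "admissible T q" "continuous_on {0<..T} q"
    and \<alpha>: "0 < \<alpha>" "\<alpha> < 1"
    and eqp: "\<And>t. t \<in> {0<..T} \<Longrightarrow> frac_integral (1 - \<alpha>) p t + lam * frac_integral 1 p t = g t"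
    and eqq: "\<And>t. t \<in> {0<..T} \<Longrightarrow> frac_integral (1 - \<alpha>) q t + lam * frac_integral 1 q t = g t"
    and t: "t \<in> {0<..T}"
  shows "p t = q t"
proof -
  let ?A = "neg_frac_op \<alpha> lam"
  define d where "d t = p t + - 1 * q t" for t
  have d: "admissible T d" "continuous_on {0<..T} d"
    unfolding d_def[abs_def] by (intro admissible_add admissible_cmult p q continuous_intros)+
  have 1: "p s + - 1 * ?A p s = q s + - 1 * ?A q s" if "s \<in> {0<..T}" for s
  proof (rule frac_integral_1_inject[OF _ _ _ _ _ that])
    show "frac_integral 1 (\<lambda>s. p s + - 1 * ?A p s) t = frac_integral 1 (\<lambda>s. q s + - 1 * ?A q s) t"
      if "t \<in> {0<..T}" for t
      using volterra_equation[OF p(1) \<alpha> eqp, of t] volterra_equation[OF q(1) \<alpha> eqq, of t] that by simp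
  qed (intro admissible_add admissible_cmult admissible_neg_frac_op p q \<alpha>
        continuous_on_add continuous_on_mult continuous_on_const continuous_on_neg_frac_op)+
  have "d s = ?A d s" if "s \<in> {0<..T}" for s
    using 1[OF that] neg_frac_op_linear[OF p(1) q(1) \<alpha>(1), of s lam "- 1"] that
    by (simp add: d_def[abs_def])
  then have "d t = 0" by (rule volterra_homogeneous_zero[OF d(1) \<alpha>(1) _ t])
  then show ?thesis by (simp add: d_def)
qed

section \<open>Equivalence of the two descriptions of the solution\<close>

text \<open>By \<open>volterra_equation\<close> and commutation, \<open>I\<^sup>\<alpha> A\<^sup>i f = I\<^sup>1 (A\<^sup>i p - A\<^sup>i\<^sup>+\<^sup>1 p)\<close>.\<close>

lemma neg_frac_op_telescope:
  assumes f: "admissible T f" and p: "admissible T p" and \<alpha>: "0 < \<alpha>" "\<alpha> < 1"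
    and eq: "\<And>t. t \<in> {0<..T} \<Longrightarrow> frac_integral (1 - \<alpha>) p t + lam * frac_integral 1 p t = f t"
    and t: "t \<in> {0<..T}"
  shows "frac_integral \<alpha> (\<lambda>s. \<Sum>i<n. (neg_frac_op \<alpha> lam ^^ i) f s) t
       = frac_integral 1 p t - frac_integral 1 ((neg_frac_op \<alpha> lam ^^ n) p) t"
proof -
  let ?A = "neg_frac_op \<alpha> lam"
  let ?S = "\<lambda>n s. \<Sum>i<n. (?A ^^ i) f s"
  note adm = admissible_add admissible_cmult admissible_neg_frac_op admissible_neg_frac_op_funpow f p \<alpha>(1)
  have t': "t \<in> {0..T}" using t by simp
  have S: "admissible T (?S n)" for n
  proof (induction n)
    case 0
    show ?case using admissible_cmult[OF f, of 0] by simp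
  next
    case (Suc n)
    then show ?case using admissible_add[OF Suc, of "(?A ^^ n) f"] by (simp add: adm)
  qed
  have step: "frac_integral \<alpha> ((?A ^^ i) f) t
      = frac_integral 1 ((?A ^^ i) p) t - frac_integral 1 ((?A ^^ Suc i) p) t" for i
  proof -
    let ?r = "\<lambda>s. p s + - 1 * ?A p s"
    have r: "admissible T ?r" by (intro adm)
    have "frac_integral \<alpha> ((?A ^^ i) f) t = (?A ^^ i) (frac_integral \<alpha> f) t"
      using t by (intro neg_frac_op_funpow_frac_integral[symmetric, of T] adm)
    also have "\<dots> = (?A ^^ i) (frac_integral 1 ?r) t"
      by (rule neg_frac_op_funpow_cong[of T]) (use volterra_equation[OF p \<alpha> eq] t in auto)
    also have "\<dots> = frac_integral 1 ((?A ^^ i) ?r) t"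
      using t by (intro neg_frac_op_funpow_frac_integral[of T] r \<alpha>) auto
    also have "\<dots> = frac_integral 1 (\<lambda>s. (?A ^^ i) p s + - 1 * (?A ^^ i) (?A p) s) t"
      by (rule frac_integral_cong[OF neg_frac_op_funpow_linear[of T p "?A p" \<alpha>] t']) (intro adm | assumption)+
    also have "\<dots> = frac_integral 1 ((?A ^^ i) p) t + - 1 * frac_integral 1 ((?A ^^ i) (?A p)) t"
      unfolding frac_integral_cmult[symmetric]
      by (rule frac_integral_add[OF _ _ zero_less_one t']) (intro adm)+
    also have "(?A ^^ i) (?A p) = (?A ^^ Suc i) p" by (simp add: funpow_swap1)
    finally show ?thesis by simp
  qed
  show ?thesis
  proof (induction n)
    case 0
    show ?case using frac_integral_cmult[of \<alpha> 0 f t] by simp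
  next
    case (Suc n)
    have "frac_integral \<alpha> (\<lambda>s. ?S n s + (?A ^^ n) f s) t
        = frac_integral \<alpha> (?S n) t + frac_integral \<alpha> ((?A ^^ n) f) t"
      by (rule frac_integral_add[OF S]) (use t' adm in auto)
    then show ?case using Suc step[of n] by simp
  qed
qed

text \<open>Applying \<open>A\<^sup>n\<close> to the integral equation for \<open>p = u'\<close> shows that \<open>A\<^sup>n p\<close> is the density of a solution for
\<open>A\<^sup>n f\<close>. By telescoping, that solution is the right-hand side, and by uniqueness it is the only one.\<close>

lemma frac_solution_funpow_iff:
  assumes \<alpha>: "0 < \<alpha>" "\<alpha> < 1" and T: "0 < T" and u: "frac_solution T \<alpha> lam f u"
  shows "frac_solution T \<alpha> lam ((neg_frac_op \<alpha> lam ^^ n) f) v \<longleftrightarrow>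
    (\<forall>t\<in>{0..T}. v t = u t - frac_integral \<alpha> (\<lambda>s. \<Sum>i<n. (neg_frac_op \<alpha> lam ^^ i) f s) t)"
proof -
  let ?A = "neg_frac_op \<alpha> lam"
  define p where "p = deriv_upto T u"
  note p = frac_solution_density[OF u, folded p_def]
  define q where "q = (?A ^^ n) p"
  have q: "admissible T q" "continuous_on {0<..T} q"
    unfolding q_def using p \<alpha> by (simp_all add: admissible_neg_frac_op_funpow continuous_on_neg_frac_op_funpow)
  have f: "admissible T f"
    by (rule admissible_cong[of T "\<lambda>t. frac_integral (1 - \<alpha>) p t + lam * frac_integral 1 p t"])
       (use p \<alpha> in \<open>auto intro!: admissible_add admissible_cmult admissible_frac_integral\<close>)
  have v_eq: "u t - frac_integral \<alpha> (\<lambda>s. \<Sum>i<n. (?A ^^ i) f s) t = frac_integral 1 q t" if t: "t \<in> {0..T}" for t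
  proof (cases "t = 0")
    case True
    then show ?thesis using t p(3)[OF t] by (simp add: frac_integral_at_0)
  next
    case False
    then show ?thesis
      using neg_frac_op_telescope[OF f p(1) \<alpha> p(4), of t n] p(3)[OF t] t by (simp add: q_def)
  qed
  have eq_q: "frac_integral (1 - \<alpha>) q t + lam * frac_integral 1 q t = (?A ^^ n) f t" if t: "t \<in> {0<..T}" for t
  proof -
    have "(?A ^^ n) f t = (?A ^^ n) (\<lambda>t. frac_integral (1 - \<alpha>) p t + lam * frac_integral 1 p t) t"
      by (rule neg_frac_op_funpow_cong[of T]) (use p(4) t in auto)
    also have "\<dots> = frac_integral (1 - \<alpha>) q t + lam * frac_integral 1 q t"
      using p(1) \<alpha> t
      by (simp add: neg_frac_op_funpow_linear[of T] neg_frac_op_funpow_frac_integral[of T]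
            admissible_frac_integral q_def)
    finally show ?thesis by simp
  qed
  show ?thesis
  proof
    assume v: "frac_solution T \<alpha> lam ((?A ^^ n) f) v"
    note d = frac_solution_density[OF v]
    have "deriv_upto T v s = q s" if "s \<in> {0<..T}" for s
      by (rule density_unique[OF d(1,2) q \<alpha> d(4) eq_q that])
    then have "v t = frac_integral 1 q t" if "t \<in> {0..T}" for t
      using d(3)[OF that] frac_integral_cong[of T "deriv_upto T v" q t 1] that by simp
    then show "\<forall>t\<in>{0..T}. v t = u t - frac_integral \<alpha> (\<lambda>s. \<Sum>i<n. (?A ^^ i) f s) t"
      using v_eq by simp
  next
    assume "\<forall>t\<in>{0..T}. v t = u t - frac_integral \<alpha> (\<lambda>s. \<Sum>i<n. (?A ^^ i) f s) t"
    then show "frac_solution T \<alpha> lam ((?A ^^ n) f) v"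
      using v_eq eq_q by (intro frac_solutionI[OF q T]) auto
  qed
qed

section \<open>Domination by powers\<close>

definition powr_dominated :: "real \<Rightarrow> real \<Rightarrow> (real \<Rightarrow> real) \<Rightarrow> bool" where
  "powr_dominated T a F \<longleftrightarrow> (\<exists>C\<ge>0. \<forall>t\<in>{0<..T}. \<bar>F t\<bar> \<le> C * t powr a)"

definition derivative_powr_dominated :: "real \<Rightarrow> real \<Rightarrow> (real \<Rightarrow> real) \<Rightarrow> bool" where
  "derivative_powr_dominated T a F \<longleftrightarrow>
     (\<exists>F'. (\<forall>t\<in>{0<..T}. (F has_real_derivative F' t) (at t within {0<..T})) \<and> powr_dominated T a F')"

lemma powr_dominated_cong:
  "powr_dominated T a F \<Longrightarrow> (\<And>t. t \<in> {0<..T} \<Longrightarrow> G t = F t) \<Longrightarrow> powr_dominated T a G"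
  by (simp add: powr_dominated_def)

lemma powr_dominated_add:
  assumes "powr_dominated T a F" "powr_dominated T a G"
  shows "powr_dominated T a (\<lambda>t. F t + G t)"
proof -
  obtain C D where "0 \<le> C" "0 \<le> D" and CD: "\<And>t. t \<in> {0<..T} \<Longrightarrow> \<bar>F t\<bar> \<le> C * t powr a"
    "\<And>t. t \<in> {0<..T} \<Longrightarrow> \<bar>G t\<bar> \<le> D * t powr a"
    using assms unfolding powr_dominated_def by blast
  moreover have "\<bar>F t + G t\<bar> \<le> (C + D) * t powr a" if "t \<in> {0<..T}" for t
    using CD[OF that] by (simp add: distrib_right)
  ultimately show ?thesis unfolding powr_dominated_def by (intro exI[of _ "C + D"]) auto
qed

lemma powr_dominated_cmult:
  assumes "powr_dominated T a F"
  shows "powr_dominated T a (\<lambda>t. c * F t)"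
proof -
  obtain C where "0 \<le> C" and C: "\<And>t. t \<in> {0<..T} \<Longrightarrow> \<bar>F t\<bar> \<le> C * t powr a"
    using assms unfolding powr_dominated_def by blast
  moreover have "\<bar>c * F t\<bar> \<le> (\<bar>c\<bar> * C) * t powr a" if "t \<in> {0<..T}" for t
    using mult_left_mono[OF C[OF that], of "\<bar>c\<bar>"] by (simp add: abs_mult mult.assoc)
  ultimately show ?thesis unfolding powr_dominated_def by (intro exI[of _ "\<bar>c\<bar> * C"]) auto
qed

lemma powr_dominated_sum:
  assumes "finite I" "\<And>i. i \<in> I \<Longrightarrow> powr_dominated T a (F i)"
  shows "powr_dominated T a (\<lambda>t. \<Sum>i\<in>I. F i t)"
  using assms
proof (induction I rule: finite_induct)
  case empty
  show ?case by (auto simp: powr_dominated_def)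
qed (simp add: powr_dominated_add)

lemma powr_dominated_mono:
  assumes "powr_dominated T a F" "b \<le> a"
  shows "powr_dominated T b F"
proof -
  obtain C where C0: "0 \<le> C" and C: "\<And>t. t \<in> {0<..T} \<Longrightarrow> \<bar>F t\<bar> \<le> C * t powr a"
    using assms unfolding powr_dominated_def by blast
  have "\<bar>F t\<bar> \<le> (C * T powr (a - b)) * t powr b" if t: "t \<in> {0<..T}" for t
  proof -
    have "t powr a = t powr (a - b) * t powr b" using t by (simp flip: powr_add)
    also have "\<dots> \<le> T powr (a - b) * t powr b"
      using t assms(2) by (intro mult_right_mono powr_mono2) auto
    finally have "C * t powr a \<le> C * (T powr (a - b) * t powr b)" using C0 by (rule mult_left_mono)
    with C[OF t] show ?thesis by (simp add: mult.assoc)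
  qed
  then show ?thesis using C0 unfolding powr_dominated_def by (intro exI[of _ "C * T powr (a - b)"]) auto
qed

lemma powr_dominated_frac_kernel:
  assumes "0 < \<nu>"
  shows "powr_dominated T (\<nu> - 1) (frac_kernel \<nu>)"
  unfolding powr_dominated_def using Gamma_real_pos[OF assms]
  by (intro exI[of _ "inverse (Gamma \<nu>)"]) (simp add: frac_kernel_def field_simps)

text \<open>Compare \<open>g\<close> with a multiple of the kernel of order \<open>1 - \<sigma>\<close>, which \<open>I\<^sup>\<nu>\<close> maps to the kernel of
order \<open>\<nu> + 1 - \<sigma>\<close>.\<close>

lemma powr_dominated_frac_integral:
  assumes g: "admissible T g" and dom: "powr_dominated T (- \<sigma>) g" and \<sigma>: "\<sigma> < 1" and \<nu>: "0 < \<nu>"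
  shows "powr_dominated T (\<nu> - \<sigma>) (frac_integral \<nu> g)"
proof -
  obtain C where C0: "0 \<le> C" and C: "\<And>t. t \<in> {0<..T} \<Longrightarrow> \<bar>g t\<bar> \<le> C * t powr (- \<sigma>)"
    using dom unfolding powr_dominated_def by blast
  have G: "0 < Gamma (1 - \<sigma>)" using \<sigma> by auto
  have "\<bar>frac_integral \<nu> g t\<bar> \<le> C * Gamma (1 - \<sigma>) * frac_kernel (\<nu> + (1 - \<sigma>)) t" if t: "t \<in> {0<..T}" for t
  proof -
    have "\<bar>frac_integral \<nu> g t\<bar> \<le> frac_integral \<nu> (\<lambda>s. C * Gamma (1 - \<sigma>) * frac_kernel (1 - \<sigma>) s) t"
    proof (rule abs_frac_integral_le[OF g admissible_cmult[OF admissible_frac_kernel]])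
      show "\<bar>g s\<bar> \<le> C * Gamma (1 - \<sigma>) * frac_kernel (1 - \<sigma>) s" if "s \<in> {0<..T}" for s
        using C[OF that] G by (simp add: frac_kernel_def)
    qed (use \<sigma> \<nu> t in auto)
    then show ?thesis
      using \<sigma> by (simp add: frac_integral_cmult frac_integral_frac_kernel[OF \<nu> _ t])
  qed
  moreover have "powr_dominated T (\<nu> - \<sigma>) (\<lambda>t. C * Gamma (1 - \<sigma>) * frac_kernel (\<nu> + (1 - \<sigma>)) t)"
    using powr_dominated_cmult[OF powr_dominated_frac_kernel[of "\<nu> + (1 - \<sigma>)" T]] \<nu> \<sigma> by (simp add: add_diff_eq)
  ultimately show ?thesis
    unfolding powr_dominated_def by (meson abs_ge_self order_trans)
qed

lemma powr_dominated_frac_integral_L1: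
  assumes g: "admissible T g" and \<nu>: "1 \<le> \<nu>"
  shows "powr_dominated T (\<nu> - 1) (frac_integral \<nu> g)"
proof -
  obtain B where B: "0 \<le> B" "\<And>t. t \<in> {0..T} \<Longrightarrow> \<bar>frac_integral 1 (\<lambda>s. \<bar>g s\<bar>) t\<bar> \<le> B"
    using frac_integral_1_bounded[OF admissible_abs[OF g]] by blast
  have "\<bar>frac_integral \<nu> g t\<bar> \<le> B * frac_kernel \<nu> t" if t: "t \<in> {0<..T}" for t
  proof -
    have "\<bar>frac_integral \<nu> g t\<bar> \<le> frac_kernel \<nu> t * frac_integral 1 (\<lambda>s. \<bar>g s\<bar>) t"
      using abs_frac_integral_le_frac_integral_1[OF g \<nu>, of t] t by simp
    also have "\<dots> \<le> frac_kernel \<nu> t * B"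
      using B(2)[of t] t \<nu> by (intro mult_left_mono) (auto simp: frac_kernel_def)
    finally show ?thesis by (simp add: mult.commute)
  qed
  moreover have "powr_dominated T (\<nu> - 1) (\<lambda>t. B * frac_kernel \<nu> t)"
    using powr_dominated_cmult[OF powr_dominated_frac_kernel[of \<nu> T]] \<nu> by simp
  ultimately show ?thesis
    unfolding powr_dominated_def by (meson abs_ge_self order_trans)
qed

lemma derivative_powr_dominatedI:
  "(\<And>t. t \<in> {0<..T} \<Longrightarrow> (F has_real_derivative F' t) (at t within {0<..T})) \<Longrightarrow> powr_dominated T a F'
    \<Longrightarrow> derivative_powr_dominated T a F"
  unfolding derivative_powr_dominated_def by blast

lemma derivative_powr_dominated_cong:
  assumes F: "derivative_powr_dominated T a F" and eq: "\<And>t. t \<in> {0<..T} \<Longrightarrow> G t = F t"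
  shows "derivative_powr_dominated T a G"
proof -
  obtain F' where F': "\<And>t. t \<in> {0<..T} \<Longrightarrow> (F has_real_derivative F' t) (at t within {0<..T})"
    and dom: "powr_dominated T a F'"
    using F unfolding derivative_powr_dominated_def by blast
  have "(G has_real_derivative F' t) (at t within {0<..T})" if t: "t \<in> {0<..T}" for t
    using F'[OF t] unfolding has_real_derivative_iff_has_vector_derivative
    by (rule has_vector_derivative_transform[rotated 2]) (use t eq in simp_all)
  then show ?thesis using dom by (rule derivative_powr_dominatedI)
qed

lemma derivative_powr_dominated_add:
  assumes "derivative_powr_dominated T a F" "derivative_powr_dominated T a G"
  shows "derivative_powr_dominated T a (\<lambda>t. F t + G t)"
proof -
  obtain F' G' where "\<And>t. t \<in> {0<..T} \<Longrightarrow> (F has_real_derivative F' t) (at t within {0<..T})"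
    "\<And>t. t \<in> {0<..T} \<Longrightarrow> (G has_real_derivative G' t) (at t within {0<..T})"
    and dom: "powr_dominated T a F'" "powr_dominated T a G'"
    using assms unfolding derivative_powr_dominated_def by blast
  then show ?thesis
    by (intro derivative_powr_dominatedI[OF _ powr_dominated_add[OF dom]] DERIV_add) auto
qed

lemma derivative_powr_dominated_cmult:
  assumes "derivative_powr_dominated T a F"
  shows "derivative_powr_dominated T a (\<lambda>t. c * F t)"
proof -
  obtain F' where "\<And>t. t \<in> {0<..T} \<Longrightarrow> (F has_real_derivative F' t) (at t within {0<..T})"
    and dom: "powr_dominated T a F'"
    using assms unfolding derivative_powr_dominated_def by blast
  then show ?thesis
    by (intro derivative_powr_dominatedI[OF _ powr_dominated_cmult[OF dom, of c]] DERIV_cmult) auto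
qed

lemma derivative_powr_dominated_sum:
  assumes "finite I" "\<And>i. i \<in> I \<Longrightarrow> derivative_powr_dominated T a (F i)"
  shows "derivative_powr_dominated T a (\<lambda>t. \<Sum>i\<in>I. F i t)"
  using assms
proof (induction I rule: finite_induct)
  case empty
  have "powr_dominated T a (\<lambda>t. 0)" by (auto simp: powr_dominated_def)
  then show ?case by (intro derivative_powr_dominatedI[where F' = "\<lambda>t. 0"]) simp_all
qed (simp add: derivative_powr_dominated_add)

lemma derivative_powr_dominated_mono:
  "derivative_powr_dominated T a F \<Longrightarrow> b \<le> a \<Longrightarrow> derivative_powr_dominated T b F"
  unfolding derivative_powr_dominated_def using powr_dominated_mono by blast

lemma derivative_powr_dominated_frac_kernel:
  assumes "0 < \<nu>"
  shows "derivative_powr_dominated T (\<nu> - 2) (frac_kernel \<nu>)"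
proof (rule derivative_powr_dominatedI)
  show "(frac_kernel \<nu> has_real_derivative (\<nu> - 1) / Gamma \<nu> * t powr (\<nu> - 2)) (at t within {0<..T})"
    if "t \<in> {0<..T}" for t
    unfolding frac_kernel_def[abs_def]
    using that Gamma_real_pos[OF assms] by (auto intro!: derivative_eq_intros)
  have "powr_dominated T (\<nu> - 2) (\<lambda>t. t powr (\<nu> - 2))"
    unfolding powr_dominated_def by (intro exI[of _ 1]) auto
  then show "powr_dominated T (\<nu> - 2) (\<lambda>t. (\<nu> - 1) / Gamma \<nu> * t powr (\<nu> - 2))"
    by (rule powr_dominated_cmult)
qed

text \<open>\<open>I\<^sup>\<nu> g = I\<^sup>1 I\<^sup>\<nu>\<^sup>-\<^sup>1 g\<close> has derivative \<open>I\<^sup>\<nu>\<^sup>-\<^sup>1 g\<close>, still of order at least 1.\<close>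

lemma derivative_powr_dominated_frac_integral_L1:
  assumes g: "admissible T g" and \<nu>: "2 \<le> \<nu>"
  shows "derivative_powr_dominated T (\<nu> - 2) (frac_integral \<nu> g)"
proof (rule derivative_powr_dominatedI)
  show "(frac_integral \<nu> g has_real_derivative frac_integral (\<nu> - 1) g t) (at t within {0<..T})"
    if "t \<in> {0<..T}" for t
    by (rule frac_integral_1_has_derivative_transfer[OF _ _ that])
       (use \<nu> g in \<open>simp_all add: admissible_frac_integral continuous_on_frac_integral frac_integral_semigroup[of T]\<close>)
  show "powr_dominated T (\<nu> - 2) (frac_integral (\<nu> - 1) g)"
    using powr_dominated_frac_integral_L1[OF g, of "\<nu> - 1"] \<nu> by simp
qed

text \<open>With \<open>F = c + I\<^sup>1 g\<close>, the semigroup law gives \<open>I\<^sup>\<nu> F = I\<^sup>1 (c \<beta>\<^sub>\<nu> + I\<^sup>\<nu> g)\<close>, and the inner function is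
continuous on \<open>(0,T]\<close>, which gives the derivative. Its second term is of size \<open>t\<^sup>\<nu>\<^sup>-\<^sup>\<sigma>\<close>, so that the
exponent is dictated by \<open>c \<beta>\<^sub>\<nu>\<close>.\<close>

lemma derivative_powr_dominated_frac_integral:
  assumes g: "admissible T g" and dom: "powr_dominated T (- \<sigma>) g" and \<sigma>: "\<sigma> < 1" and \<nu>: "0 < \<nu>"
    and F: "\<And>t. t \<in> {0<..T} \<Longrightarrow> F t = c + frac_integral 1 g t"
  shows "derivative_powr_dominated T (\<nu> - 1) (frac_integral \<nu> F)"
proof (rule derivative_powr_dominatedI)
  let ?p = "\<lambda>t. c * frac_kernel \<nu> t + frac_integral \<nu> g t"
  have k: "admissible T (frac_kernel \<nu>)" "admissible T (frac_kernel 1)"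
    using \<nu> by (simp_all add: admissible_frac_kernel)
  note Ig = admissible_frac_integral[OF g]
  have p: "admissible T ?p" by (intro admissible_add admissible_cmult Ig k \<nu>)
  have cont: "continuous_on {0<..T} ?p"
    unfolding frac_kernel_def divide_inverse
    by (intro continuous_intros continuous_on_frac_integral g \<nu>) auto
  show "(frac_integral \<nu> F has_real_derivative ?p t) (at t within {0<..T})" if t: "t \<in> {0<..T}" for t
  proof (rule frac_integral_1_has_derivative_transfer[OF p cont t])
    fix t assume t: "t \<in> {0<..T}"
    then have t': "t \<in> {0..T}" by simp
    have "frac_integral \<nu> F t = frac_integral \<nu> (\<lambda>s. c * frac_kernel 1 s + frac_integral 1 g s) t"
      by (rule frac_integral_cong[OF _ t']) (simp add: F frac_kernel_def)
    also have "\<dots> = c * frac_kernel (\<nu> + 1) t + frac_integral (\<nu> + 1) g t"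
      by (simp add: frac_integral_add[OF admissible_cmult[OF k(2)] Ig \<nu> t'] frac_integral_cmult
            frac_integral_frac_kernel[OF \<nu> _ t] frac_integral_semigroup[OF g \<nu> _ t'])
    also have "\<dots> = frac_integral 1 ?p t"
      by (simp add: frac_integral_add[OF admissible_cmult[OF k(1)] Ig[OF \<nu>] _ t'] frac_integral_cmult
            frac_integral_frac_kernel[OF _ \<nu> t] frac_integral_semigroup[OF g _ \<nu> t'] add.commute[of 1 \<nu>])
    finally show "frac_integral \<nu> F t = frac_integral 1 ?p t" .
  qed
  have "powr_dominated T (\<nu> - 1) (frac_integral \<nu> g)"
    using powr_dominated_frac_integral[OF g dom \<sigma> \<nu>] by (rule powr_dominated_mono) (use \<sigma> in simp)
  then show "powr_dominated T (\<nu> - 1) ?p"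
    by (intro powr_dominated_add powr_dominated_cmult powr_dominated_frac_kernel \<nu>)
qed

section \<open>Functions as integrals of their derivatives\<close>

text \<open>The derivative may be discontinuous, but it is a pointwise limit of difference quotients.\<close>

lemma derivative_measurable:
  assumes T: "0 < T" and f: "f differentiable_on {0<..T}"
  shows "zero_ext T (deriv_upto T f) \<in> borel_measurable borel"
proof -
  let ?e = "zero_ext T f"
  define u where "u n t = (if t \<in> {0<..<T} then (?e (t + inverse (real (Suc n))) - ?e t) / inverse (real (Suc n)) else 0)"
    for n t
  \<comment> \<open>The one-sided derivative at \<open>T\<close> is not reached by forward difference quotients; it is restored at the end.\<close>
  define G where "G t = (if t \<in> {0<..<T} then deriv_upto T f t else 0)" for t
  have [measurable]: "?e \<in> borel_measurable borel"
    by (intro zero_ext_measurable differentiable_imp_continuous_on f)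
  have "(\<lambda>n. u n t) \<longlonglongrightarrow> G t" for t
  proof (cases "t \<in> {0<..<T}")
    case t: True
    have "f differentiable (at t within {0<..T})" using f t by (auto simp: differentiable_on_def)
    then have "(f has_vector_derivative deriv_upto T f t) (at t within {0<..T})"
      by (simp add: vector_derivative_works deriv_upto_def)
    moreover have "at t within {0<..T} = at t"
      by (rule at_within_nhd[of t "{0<..<T}"]) (use t in auto)
    ultimately have "(f has_real_derivative deriv_upto T f t) (at t)"
      by (simp add: has_real_derivative_iff_has_vector_derivative)
    then have "((\<lambda>h. (f (t + h) - f t) / h) \<longlongrightarrow> deriv_upto T f t) (at 0)"
      by (simp add: DERIV_def)
    moreover have "filterlim (\<lambda>n. inverse (real (Suc n))) (at 0) sequentially"
      using LIMSEQ_inverse_real_of_nat by (intro filterlim_atI) auto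
    ultimately have "(\<lambda>n. (f (t + inverse (real (Suc n))) - f t) / inverse (real (Suc n))) \<longlonglongrightarrow> deriv_upto T f t"
      by (rule filterlim_compose)
    moreover have "\<forall>\<^sub>F n in sequentially. inverse (real (Suc n)) < T - t"
      using LIMSEQ_inverse_real_of_nat by (rule order_tendstoD) (use t in auto)
    then have "\<forall>\<^sub>F n in sequentially. (f (t + inverse (real (Suc n))) - f t) / inverse (real (Suc n)) = u n t"
    proof eventually_elim
      case (elim n)
      have "0 < inverse (real (Suc n))" by simp
      then have "t + inverse (real (Suc n)) \<in> {0<..T}" using elim t
        by (simp only: greaterThanAtMost_iff greaterThanLessThan_iff) linarith
      then show ?case using t by (simp add: u_def zero_ext_def)
    qed
    ultimately have "(\<lambda>n. u n t) \<longlonglongrightarrow> deriv_upto T f t" by (rule Lim_transform_eventually)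
    then show ?thesis using t by (simp add: G_def)
  next
    case False
    then have "(\<lambda>n. u n t) = (\<lambda>n. G t)" by (simp add: u_def G_def fun_eq_iff del: greaterThanLessThan_iff)
    then show ?thesis by simp
  qed
  moreover have "u n \<in> borel_measurable borel" for n unfolding u_def[abs_def] by measurable
  ultimately have [measurable]: "G \<in> borel_measurable borel" by (rule borel_measurable_LIMSEQ_real)
  have "zero_ext T (deriv_upto T f) = (\<lambda>t. if t = T then deriv_upto T f T else G t)"
    using T by (auto simp: zero_ext_def G_def)
  also have "\<dots> \<in> borel_measurable borel" by measurable
  finally show ?thesis .
qed

text \<open>Integrate \<open>f'\<close> over \<open>[t,T]\<close>, where it is bounded; this holds for any derivative in the
Henstock-Kurzweil sense. As \<open>\<sigma> < 1\<close>, the integral of \<open>f'\<close> from 0 converges, and \<open>c\<close> is the limit of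
\<open>f\<close> at 0.\<close>

lemma primitive_of_powr_dominated_derivative:
  assumes T: "0 < T" and f: "f differentiable_on {0<..T}"
    and dom: "powr_dominated T (- \<sigma>) (deriv_upto T f)" and \<sigma>: "\<sigma> < 1"
  shows "admissible T (deriv_upto T f)"
    and "\<exists>c. \<forall>t\<in>{0<..T}. f t = c + frac_integral 1 (deriv_upto T f) t"
proof -
  let ?g = "deriv_upto T f"
  obtain C where C0: "0 \<le> C" and C: "\<And>t. t \<in> {0<..T} \<Longrightarrow> \<bar>?g t\<bar> \<le> C * t powr (- \<sigma>)"
    using dom unfolding powr_dominated_def by blast
  let ?h = "\<lambda>s. C * Gamma (1 - \<sigma>) * frac_kernel (1 - \<sigma>) s"
  have G: "0 < Gamma (1 - \<sigma>)" using \<sigma> by auto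
  have h: "admissible T ?h" using \<sigma> by (intro admissible_cmult admissible_frac_kernel) simp
  have le: "\<bar>?g s\<bar> \<le> ?h s" if "s \<in> {0<..T}" for s
    using C[OF that] G by (simp add: frac_kernel_def)
  show g: "admissible T ?g"
    unfolding admissible_def
  proof (intro conjI allI impI)
    show "integrable lborel (zero_ext T ?g)"
      using admissible_integrable[OF h]
    proof (rule Bochner_Integration.integrable_bound)
      have "norm (zero_ext T ?g s) \<le> norm (zero_ext T ?h s)" for s
        using le[of s] abs_ge_self[of "?h s"]
        by (cases "s \<in> {0<..T}") (simp_all add: zero_ext_def del: greaterThanAtMost_iff)
      then show "AE s in lborel. norm (zero_ext T ?g s) \<le> norm (zero_ext T ?h s)" by simp
    qed (simp add: derivative_measurable[OF T f])
    fix a :: real assume a: "0 < a"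
    then obtain M where "\<forall>t\<in>{a..T}. \<bar>?h t\<bar> \<le> M" using h unfolding admissible_def by blast
    moreover have "\<bar>?g t\<bar> \<le> \<bar>?h t\<bar>" if "t \<in> {a..T}" for t
      using le[of t] abs_ge_self[of "?h t"] a that by simp
    ultimately have "\<forall>t\<in>{a..T}. \<bar>?g t\<bar> \<le> M" by (meson order_trans)
    then show "\<exists>M. \<forall>t\<in>{a..T}. \<bar>?g t\<bar> \<le> M" ..
  qed
  have "f t = (f T - frac_integral 1 ?g T) + frac_integral 1 ?g t" if t: "t \<in> {0<..T}" for t
  proof -
    have "(?g has_integral f T - f t) {t..T}"
    proof (rule fundamental_theorem_of_calculus)
      fix x assume x: "x \<in> {t..T}"
      then have "f differentiable (at x within {0<..T})" using f t by (auto simp: differentiable_on_def)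
      then have "(f has_vector_derivative ?g x) (at x within {0<..T})"
        by (simp add: vector_derivative_works deriv_upto_def)
      then show "(f has_vector_derivative ?g x) (at x within {t..T})"
        by (rule has_vector_derivative_within_subset) (use t in auto)
    qed (use t in simp)
    then have "integral {t..T} ?g = f T - f t" by (rule integral_unique)
    then show ?thesis using frac_integral_1_diff[OF g, of t T] t by simp
  qed
  then show "\<exists>c. \<forall>t\<in>{0<..T}. f t = c + frac_integral 1 ?g t" by blast
qed

section \<open>Expansion and bounds of the derivative of the solution\<close>

text \<open>The equation for \<open>q = v'\<close> is \<open>q = (-lam)\<^sup>n h - lam I\<^sup>\<alpha> q\<close> with \<open>h = c \<beta>\<^bsub>(n+1)\<alpha>\<^esub> + I\<^bsup>(n+1)\<alpha>\<^esup> g\<close>. The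
expansion is its \<open>m\<close>-fold substitution into itself; the remainder carries an integral of order
\<open>(m+1)\<alpha>\<close>, large enough for crude estimates once \<open>m\<close> is.\<close>

lemma density_expansion:
  assumes \<alpha>: "0 < \<alpha>" "\<alpha> < 1" and v: "frac_solution T \<alpha> lam ((neg_frac_op \<alpha> lam ^^ n) f) v"
    and g: "admissible T g" and f_eq: "\<And>t. t \<in> {0<..T} \<Longrightarrow> f t = c + frac_integral 1 g t"
    and t: "t \<in> {0<..T}"
  defines "q \<equiv> deriv_upto T v"
  shows "q t = (\<Sum>i\<le>m. (- lam) ^ (n + i) *
            (c * frac_kernel (real (n + 1 + i) * \<alpha>) t + frac_integral (real (n + 1 + i) * \<alpha>) g t))
          + (- lam) ^ Suc m * frac_integral (real (Suc m) * \<alpha>) q t"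
proof -
  let ?A = "neg_frac_op \<alpha> lam"
  note q = frac_solution_density[OF v, folded q_def]
  define \<beta> where "\<beta> = real (n + 1) * \<alpha>"
  have \<beta>: "0 < \<beta>" using \<alpha> by (simp add: \<beta>_def)
  have k: "admissible T (frac_kernel \<nu>)" if "0 < \<nu>" for \<nu> using that by (rule admissible_frac_kernel)
  note Ig = admissible_frac_integral[OF g]
  define h where "h t = c * frac_kernel \<beta> t + frac_integral \<beta> g t" for t
  have h: "admissible T h" unfolding h_def[abs_def] by (intro admissible_add admissible_cmult k Ig \<beta>)
  have cont_h: "continuous_on {0<..T} h"
    unfolding h_def[abs_def] frac_kernel_def divide_inverse
    by (intro continuous_intros continuous_on_frac_integral g \<beta>) auto
  have Ih: "frac_integral \<nu> h t = c * frac_kernel (\<nu> + \<beta>) t + frac_integral (\<nu> + \<beta>) g t"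
    if "0 < \<nu>" "t \<in> {0<..T}" for \<nu> t
  proof -
    have t': "t \<in> {0..T}" using that by simp
    show ?thesis
      unfolding h_def[abs_def]
      by (simp add: frac_integral_add[OF admissible_cmult[OF k[OF \<beta>]] Ig[OF \<beta>] that(1) t'] frac_integral_cmult
            frac_integral_frac_kernel[OF that(1) \<beta> that(2)] frac_integral_semigroup[OF g that(1) \<beta> t'])
  qed
  have f': "f t = c * frac_kernel 1 t + frac_integral 1 g t" if "t \<in> {0<..T}" for t
    using f_eq[OF that] that by (simp add: frac_kernel_def)
  have f: "admissible T f"
    by (rule admissible_cong[of T "\<lambda>t. c * frac_kernel 1 t + frac_integral 1 g t"])
       (simp_all add: f' admissible_add admissible_cmult k Ig)
  have fix_q: "q s = (- lam) ^ n * h s + - lam * frac_integral \<alpha> q s" if s: "s \<in> {0<..T}" for s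
  proof -
    have "q s + - 1 * ?A q s = (- lam) ^ n * h s"
    proof (rule frac_integral_1_inject[OF _ _ _ _ _ s])
      fix t assume t: "t \<in> {0<..T}"
      then have t': "t \<in> {0..T}" by simp
      have "frac_integral 1 (\<lambda>s. q s + - 1 * ?A q s) t = frac_integral \<alpha> ((?A ^^ n) f) t"
        using volterra_equation[OF q(1) \<alpha> q(4) t'] by simp
      also have "\<dots> = (- lam) ^ n * frac_integral \<beta> f t"
        using frac_integral_neg_frac_op_funpow[OF f \<alpha>(1) \<alpha>(1) t'] by (simp add: \<beta>_def algebra_simps)
      also have "frac_integral \<beta> f t = frac_integral \<beta> (\<lambda>s. c * frac_kernel 1 s + frac_integral 1 g s) t"
        by (rule frac_integral_cong[OF f' t'])
      also have "\<dots> = c * frac_kernel (1 + \<beta>) t + frac_integral (1 + \<beta>) g t"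
        by (simp add: frac_integral_add[OF admissible_cmult[OF k] Ig \<beta> t'] frac_integral_cmult
              frac_integral_frac_kernel[OF \<beta> _ t] frac_integral_semigroup[OF g \<beta> _ t'] add.commute[of 1 \<beta>])
      also have "\<dots> = frac_integral 1 h t" using t by (simp add: Ih)
      finally show "frac_integral 1 (\<lambda>s. q s + - 1 * ?A q s) t = frac_integral 1 (\<lambda>s. (- lam) ^ n * h s) t"
        by (simp only: frac_integral_cmult)
    qed (intro admissible_add admissible_cmult admissible_neg_frac_op q h \<alpha> cont_h
        continuous_on_add continuous_on_mult continuous_on_const continuous_on_neg_frac_op)+
    then show ?thesis by (simp add: neg_frac_op_def)
  qed
  show ?thesis
  proof (induction m)
    case 0
    show ?case using fix_q[OF t] by (simp add: h_def \<beta>_def)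
  next
    case (Suc m)
    have t': "t \<in> {0..T}" using t by simp
    define \<mu> where "\<mu> = real (Suc m) * \<alpha>"
    have \<mu>: "0 < \<mu>" using \<alpha> by (simp add: \<mu>_def)
    have "frac_integral \<mu> q t = frac_integral \<mu> (\<lambda>s. (- lam) ^ n * h s + - lam * frac_integral \<alpha> q s) t"
      by (rule frac_integral_cong[OF fix_q t'])
    also have "\<dots> = (- lam) ^ n * frac_integral \<mu> h t + - lam * frac_integral (\<mu> + \<alpha>) q t"
      unfolding frac_integral_add[OF admissible_cmult[OF h] admissible_cmult[OF admissible_frac_integral[OF q(1) \<alpha>(1)]] \<mu> t']
        frac_integral_cmult frac_integral_semigroup[OF q(1) \<mu> \<alpha>(1) t'] ..
    also have "frac_integral \<mu> h t = c * frac_kernel (real (n + 1 + Suc m) * \<alpha>) t + frac_integral (real (n + 1 + Suc m) * \<alpha>) g t"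
    proof -
      have "\<mu> + \<beta> = real (n + 1 + Suc m) * \<alpha>" by (simp add: \<mu>_def \<beta>_def algebra_simps)
      then show ?thesis using Ih[OF \<mu> t] by simp
    qed
    also have "\<mu> + \<alpha> = real (Suc (Suc m)) * \<alpha>" by (simp add: \<mu>_def algebra_simps)
    finally have "(- lam) ^ Suc m * frac_integral \<mu> q t
       = (- lam) ^ (n + Suc m) * (c * frac_kernel (real (n + 1 + Suc m) * \<alpha>) t + frac_integral (real (n + 1 + Suc m) * \<alpha>) g t)
         + (- lam) ^ Suc (Suc m) * frac_integral (real (Suc (Suc m)) * \<alpha>) q t"
      by (simp only: distrib_left power_add power_Suc mult_ac)
    then show ?case using Suc by (simp only: \<mu>_def sum.atMost_Suc add.assoc)
  qed
qed

text \<open>The remainder of the expansion needs an order that is both at least \<open>b\<close>, so that integrability of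
\<open>q\<close> suffices to estimate it (or its derivative), and at least \<open>(n+1)\<alpha>\<close>, so that the estimate is no worse
than the leading term.\<close>

lemma large_multiple:
  fixes \<alpha> b :: real
  assumes "0 < \<alpha>"
  obtains m where "b \<le> real (Suc m) * \<alpha>" "real (n + 1) * \<alpha> \<le> real (Suc m) * \<alpha>"
proof -
  obtain k :: nat where "b / \<alpha> < real k" using reals_Archimedean2 by blast
  then have "b \<le> real k * \<alpha>" using assms by (simp add: field_simps)
  also have "\<dots> \<le> real (Suc (n + k)) * \<alpha>" using assms by (intro mult_right_mono) auto
  finally have "b \<le> real (Suc (n + k)) * \<alpha>" .
  moreover have "real (n + 1) * \<alpha> \<le> real (Suc (n + k)) * \<alpha>"
    using assms by (intro mult_right_mono) auto
  ultimately show ?thesis by (rule that)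
qed

lemma frac_solution_deriv_powr_dominated:
  assumes \<alpha>: "0 < \<alpha>" "\<alpha> < 1" and v: "frac_solution T \<alpha> lam ((neg_frac_op \<alpha> lam ^^ n) f) v"
    and g: "admissible T g" and f_eq: "\<And>t. t \<in> {0<..T} \<Longrightarrow> f t = c + frac_integral 1 g t"
    and dom: "powr_dominated T (- \<sigma>) g" and \<sigma>: "\<sigma> < 1"
  shows "powr_dominated T (real (n + 1) * \<alpha> - 1) (deriv_upto T v)"
proof -
  let ?q = "deriv_upto T v"
  let ?a = "real (n + 1) * \<alpha> - 1"
  obtain m where m: "1 \<le> real (Suc m) * \<alpha>" "real (n + 1) * \<alpha> \<le> real (Suc m) * \<alpha>"
    using large_multiple[OF \<alpha>(1)] by blast
  have "powr_dominated T ?a (\<lambda>t. (\<Sum>i\<le>m. (- lam) ^ (n + i) *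
            (c * frac_kernel (real (n + 1 + i) * \<alpha>) t + frac_integral (real (n + 1 + i) * \<alpha>) g t))
          + (- lam) ^ Suc m * frac_integral (real (Suc m) * \<alpha>) ?q t)"
  proof (intro powr_dominated_add powr_dominated_sum powr_dominated_cmult finite_atMost)
    fix i
    define \<nu> where "\<nu> = real (n + 1 + i) * \<alpha>"
    have "real (n + 1) * \<alpha> \<le> \<nu>" unfolding \<nu>_def using \<alpha> by (intro mult_right_mono) auto
    moreover have "0 < real (n + 1) * \<alpha>" using \<alpha> by (intro mult_pos_pos) auto
    ultimately have \<nu>: "0 < \<nu>" "?a \<le> \<nu> - 1" by linarith+
    show "powr_dominated T ?a (frac_kernel (real (n + 1 + i) * \<alpha>))"
      unfolding \<nu>_def[symmetric]
      using powr_dominated_frac_kernel[OF \<nu>(1)] \<nu>(2) by (rule powr_dominated_mono)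
    show "powr_dominated T ?a (frac_integral (real (n + 1 + i) * \<alpha>) g)"
      unfolding \<nu>_def[symmetric]
      using powr_dominated_frac_integral[OF g dom \<sigma> \<nu>(1)] by (rule powr_dominated_mono) (use \<nu>(2) \<sigma> in simp)
  next
    show "powr_dominated T ?a (frac_integral (real (Suc m) * \<alpha>) ?q)"
      using powr_dominated_frac_integral_L1[OF frac_solution_density(1)[OF v] m(1)]
      by (rule powr_dominated_mono) (use m(2) in simp)
  qed
  then show ?thesis
    by (rule powr_dominated_cong) (rule density_expansion[OF \<alpha> v g f_eq])
qed

lemma frac_solution_second_deriv_powr_dominated:
  assumes \<alpha>: "0 < \<alpha>" "\<alpha> < 1" and v: "frac_solution T \<alpha> lam ((neg_frac_op \<alpha> lam ^^ n) f) v"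
    and g: "admissible T g" and f_eq: "\<And>t. t \<in> {0<..T} \<Longrightarrow> f t = c + frac_integral 1 g t"
    and h: "admissible T h" and g_eq: "\<And>t. t \<in> {0<..T} \<Longrightarrow> g t = d + frac_integral 1 h t"
    and dom: "powr_dominated T (- \<sigma>) h" and \<sigma>: "\<sigma> < 1"
  shows "derivative_powr_dominated T (real (n + 1) * \<alpha> - 2) (deriv_upto T v)"
proof -
  let ?q = "deriv_upto T v"
  let ?a = "real (n + 1) * \<alpha> - 2"
  obtain m where m: "2 \<le> real (Suc m) * \<alpha>" "real (n + 1) * \<alpha> \<le> real (Suc m) * \<alpha>"
    using large_multiple[OF \<alpha>(1)] by blast
  have "derivative_powr_dominated T ?a (\<lambda>t. (\<Sum>i\<le>m. (- lam) ^ (n + i) *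
            (c * frac_kernel (real (n + 1 + i) * \<alpha>) t + frac_integral (real (n + 1 + i) * \<alpha>) g t))
          + (- lam) ^ Suc m * frac_integral (real (Suc m) * \<alpha>) ?q t)"
  proof (intro derivative_powr_dominated_add derivative_powr_dominated_sum derivative_powr_dominated_cmult finite_atMost)
    fix i
    define \<nu> where "\<nu> = real (n + 1 + i) * \<alpha>"
    have "real (n + 1) * \<alpha> \<le> \<nu>" unfolding \<nu>_def using \<alpha> by (intro mult_right_mono) auto
    moreover have "0 < real (n + 1) * \<alpha>" using \<alpha> by (intro mult_pos_pos) auto
    ultimately have \<nu>: "0 < \<nu>" "?a \<le> \<nu> - 2" by linarith+
    show "derivative_powr_dominated T ?a (frac_kernel (real (n + 1 + i) * \<alpha>))"
      unfolding \<nu>_def[symmetric]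
      using derivative_powr_dominated_frac_kernel[OF \<nu>(1)] \<nu>(2) by (rule derivative_powr_dominated_mono)
    show "derivative_powr_dominated T ?a (frac_integral (real (n + 1 + i) * \<alpha>) g)"
      unfolding \<nu>_def[symmetric]
      using derivative_powr_dominated_frac_integral[OF h dom \<sigma> \<nu>(1) g_eq]
      by (rule derivative_powr_dominated_mono) (use \<nu>(2) in simp_all)
  next
    show "derivative_powr_dominated T ?a (frac_integral (real (Suc m) * \<alpha>) ?q)"
      using derivative_powr_dominated_frac_integral_L1[OF frac_solution_density(1)[OF v] m(1)]
      by (rule derivative_powr_dominated_mono) (use m(2) in simp)
  qed
  then show ?thesis
    by (rule derivative_powr_dominated_cong) (rule density_expansion[OF \<alpha> v g f_eq])
qed

lemma powr_dominated_iff_pos: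
  "powr_dominated T a F \<longleftrightarrow> (\<exists>Q>0. \<forall>t\<in>{0<..T}. \<bar>F t\<bar> \<le> Q * t powr a)"
proof
  assume "powr_dominated T a F"
  then obtain C where C0: "0 \<le> C" and C: "\<And>t. t \<in> {0<..T} \<Longrightarrow> \<bar>F t\<bar> \<le> C * t powr a"
    unfolding powr_dominated_def by blast
  have "\<bar>F t\<bar> \<le> (C + 1) * t powr a" if "t \<in> {0<..T}" for t
    using C[OF that] by (simp add: distrib_right add_increasing2)
  then show "\<exists>Q>0. \<forall>t\<in>{0<..T}. \<bar>F t\<bar> \<le> Q * t powr a"
    using C0 by (intro exI[of _ "C + 1"]) auto
qed (auto simp: powr_dominated_def intro: less_imp_le)

theorem theorem2p1:
  fixes \<alpha> T lam :: real and f :: "real \<Rightarrow> real" and n :: nat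
  assumes "0 < \<alpha>" and "\<alpha> < 1" and "0 < T"
    and "bounded (f ` {0..T})"
    and "n \<ge> 1"
  shows
    "(\<forall>u v. frac_solution T \<alpha> lam f u \<longrightarrow>
        (frac_solution T \<alpha> lam ((neg_frac_op \<alpha> lam ^^ n) f) v \<longleftrightarrow>
         (\<forall>t\<in>{0..T}. v t =
            u t - frac_integral \<alpha> (\<lambda>s. \<Sum>i<n. (neg_frac_op \<alpha> lam ^^ i) f s) t)))
     \<and>
     (\<forall>v. frac_solution T \<alpha> lam ((neg_frac_op \<alpha> lam ^^ n) f) v \<longrightarrow>
        ((\<exists>f0. (f \<longlongrightarrow> f0) (at_right 0)) \<and>
         f differentiable_on {0<..T} \<and>
         (\<exists>\<sigma><1. \<exists>Q>0. \<forall>t\<in>{0<..T}. \<bar>deriv_upto T f t\<bar> \<le> Q * t powr (- \<sigma>))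
         \<longrightarrow>
         v differentiable_on {0<..T} \<and>
         (\<exists>Q>0. \<forall>t\<in>{0<..T}.
            \<bar>deriv_upto T v t\<bar> \<le> Q * t powr (real (n + 1) * \<alpha> - 1)))
        \<and>
        ((\<exists>f1. (deriv_upto T f \<longlongrightarrow> f1) (at_right 0)) \<and>
         f differentiable_on {0<..T} \<and>
         deriv_upto T f differentiable_on {0<..T} \<and>
         (\<exists>\<sigma><1. \<exists>Q>0. \<forall>t\<in>{0<..T}.
            \<bar>deriv_upto T (deriv_upto T f) t\<bar> \<le> Q * t powr (- \<sigma>))
         \<longrightarrow>
         v differentiable_on {0<..T} \<and>
         deriv_upto T v differentiable_on {0<..T} \<and>
         (\<exists>Q>0. \<forall>t\<in>{0<..T}.
            \<bar>deriv_upto T (deriv_upto T v) t\<bar> \<le> Q * t powr (real (n + 1) * \<alpha> - 2))))"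
proof (intro conjI allI impI)
  note \<alpha> = assms(1,2) and T = assms(3)
  show "frac_solution T \<alpha> lam ((neg_frac_op \<alpha> lam ^^ n) f) v \<longleftrightarrow>
    (\<forall>t\<in>{0..T}. v t = u t - frac_integral \<alpha> (\<lambda>s. \<Sum>i<n. (neg_frac_op \<alpha> lam ^^ i) f s) t)"
    if "frac_solution T \<alpha> lam f u" for u v
    using that by (rule frac_solution_funpow_iff[OF \<alpha> T])
next
  note \<alpha> = assms(1,2) and T = assms(3)
  fix v assume v: "frac_solution T \<alpha> lam ((neg_frac_op \<alpha> lam ^^ n) f) v"
  then show dv: "v differentiable_on {0<..T}" by (simp add: frac_solution_def)
  then show "v differentiable_on {0<..T}" .
  let ?f' = "deriv_upto T f"
  {
    assume hyp: "(\<exists>f0. (f \<longlongrightarrow> f0) (at_right 0)) \<and> f differentiable_on {0<..T} \<and>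
         (\<exists>\<sigma><1. \<exists>Q>0. \<forall>t\<in>{0<..T}. \<bar>?f' t\<bar> \<le> Q * t powr (- \<sigma>))"
    then obtain \<sigma> where \<sigma>: "\<sigma> < 1" and dom: "powr_dominated T (- \<sigma>) ?f'"
      unfolding powr_dominated_iff_pos by blast
    have df: "f differentiable_on {0<..T}" using hyp by blast
    obtain c where c: "\<forall>t\<in>{0<..T}. f t = c + frac_integral 1 ?f' t"
      using primitive_of_powr_dominated_derivative(2)[OF T df dom \<sigma>] by blast
    show "\<exists>Q>0. \<forall>t\<in>{0<..T}. \<bar>deriv_upto T v t\<bar> \<le> Q * t powr (real (n + 1) * \<alpha> - 1)"
      unfolding powr_dominated_iff_pos[symmetric]
      using frac_solution_deriv_powr_dominated[OF \<alpha> v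
          primitive_of_powr_dominated_derivative(1)[OF T df dom \<sigma>] _ dom \<sigma>] c by blast
  }
  let ?f'' = "deriv_upto T (deriv_upto T f)"
  assume hyp: "(\<exists>f1. (?f' \<longlongrightarrow> f1) (at_right 0)) \<and> f differentiable_on {0<..T} \<and>
         ?f' differentiable_on {0<..T} \<and>
         (\<exists>\<sigma><1. \<exists>Q>0. \<forall>t\<in>{0<..T}. \<bar>?f'' t\<bar> \<le> Q * t powr (- \<sigma>))"
  then obtain \<sigma> where \<sigma>: "\<sigma> < 1" and dom: "powr_dominated T (- \<sigma>) ?f''"
    unfolding powr_dominated_iff_pos by blast
  have df: "f differentiable_on {0<..T}" and df': "?f' differentiable_on {0<..T}" using hyp by blast+
  note adm'' = primitive_of_powr_dominated_derivative(1)[OF T df' dom \<sigma>]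
  obtain d where d: "\<forall>t\<in>{0<..T}. ?f' t = d + frac_integral 1 ?f'' t"
    using primitive_of_powr_dominated_derivative(2)[OF T df' dom \<sigma>] by blast
  \<comment> \<open>The bound on \<open>f''\<close> makes \<open>f'\<close> bounded, so that \<open>f\<close> is itself a primitive with exponent \<open>\<sigma> = 0\<close>.\<close>
  have dom': "powr_dominated T (- 0) ?f'"
  proof -
    obtain B where B: "0 \<le> B" "\<And>t. t \<in> {0..T} \<Longrightarrow> \<bar>frac_integral 1 ?f'' t\<bar> \<le> B"
      using frac_integral_1_bounded[OF adm''] by blast
    have "\<bar>?f' t\<bar> \<le> (\<bar>d\<bar> + B) * t powr (- 0)" if "t \<in> {0<..T}" for t
      using d[rule_format, OF that] B(2)[of t] that by simp
    then show ?thesis unfolding powr_dominated_def using B(1) by (intro exI[of _ "\<bar>d\<bar> + B"]) auto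
  qed
  note adm' = primitive_of_powr_dominated_derivative(1)[OF T df dom' zero_less_one]
  obtain c where c: "\<forall>t\<in>{0<..T}. f t = c + frac_integral 1 ?f' t"
    using primitive_of_powr_dominated_derivative(2)[OF T df dom' zero_less_one] by blast
  have "derivative_powr_dominated T (real (n + 1) * \<alpha> - 2) (deriv_upto T v)"
    using frac_solution_second_deriv_powr_dominated[OF \<alpha> v adm' _ adm'' _ dom \<sigma>] c d by blast
  then obtain F where F: "\<And>t. t \<in> {0<..T} \<Longrightarrow> (deriv_upto T v has_real_derivative F t) (at t within {0<..T})"
    and domF: "powr_dominated T (real (n + 1) * \<alpha> - 2) F"
    unfolding derivative_powr_dominated_def by blast
  show "deriv_upto T v differentiable_on {0<..T}"
    unfolding differentiable_on_def using F real_differentiable_def by blast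
  show "\<exists>Q>0. \<forall>t\<in>{0<..T}. \<bar>deriv_upto T (deriv_upto T v) t\<bar> \<le> Q * t powr (real (n + 1) * \<alpha> - 2)"
    unfolding powr_dominated_iff_pos[symmetric]
    using domF by (rule powr_dominated_cong) (rule deriv_upto_eqI[OF F])
qed

end
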